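(* Let $G$ be a simple graph on $n$ vertices with at least one edge, and let $0=\mu_1\le\mu_2\le\cdots\le\mu_n$ be the eigenvalues of its Laplacian matrix. Let $s$ be an integer with $2\le s<n$ and $n+s$ even. If $\frac{\mu_2}{\mu_n}>\frac{s}{s+2}$, then $G$ is $(1,s)$-factor-critical.
   Context: The Laplacian matrix of $G$ is $L=D-A$ ($D$ diagonal degree matrix, $A$ adjacency matrix); $\mu_i$ is its $i$-th smallest eigenvalue. A graph $G$ is $(k,s)$-factor-critical if for every vertex subset $X\subseteq V(G)$ with $|X|=s$, the graph $G-X$ (obtained by deleting $X$) has a $k$-factor, i.e. a spanning subgraph in which every vertex has degree exactly $k$. In particular, $(1,s)$-factor-critical means $G-X$ has a perfect matching for every $s$-subset $X$. *)

theory Defs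
  imports
    "Graph_Theory.Digraph_Component"
    "Jordan_Normal_Form.Char_Poly"
begin

text \<open>
  A finite simple graph is represented by the locale \<^locale>\<open>graph\<close>: a finite symmetric digraph
  without loops and parallel arcs. Each edge \<open>{u, v}\<close> is thus the pair of arcs \<open>u \<rightarrow> v\<close> and
  \<open>v \<rightarrow> u\<close>, and the degree of a vertex is its out-degree.
\<close>

text \<open>
  The matrices are taken with respect to an enumeration \<open>vs\<close> of the vertices (a distinct list with
  \<open>set vs = verts G\<close>).
\<close>

definition degree_mat :: "('a, 'b) pre_digraph \<Rightarrow> 'a list \<Rightarrow> real mat" where
  "degree_mat G vs = mat (length vs) (length vs)
     (\<lambda>(i, j). if i = j then real (out_degree G (vs ! i)) else 0)"

definition adjacency_mat :: "('a, 'b) pre_digraph \<Rightarrow> 'a list \<Rightarrow> real mat" where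
  "adjacency_mat G vs = mat (length vs) (length vs)
     (\<lambda>(i, j). if (vs ! i) \<rightarrow>\<^bsub>G\<^esub> (vs ! j) then 1 else 0)"

definition laplacian_mat :: "('a, 'b) pre_digraph \<Rightarrow> 'a list \<Rightarrow> real mat" where
  "laplacian_mat G vs = degree_mat G vs - adjacency_mat G vs"

text \<open>
  The real eigenvalues of a square matrix, repeated according to algebraic multiplicity, in
  increasing order. For a real symmetric \<open>n \<times> n\<close> matrix, such as a Laplacian, all roots of the
  characteristic polynomial are real, so the list has length \<open>n\<close>. The index of
  \<open>nth_eigenvalue\<close> starts at 1.
\<close>

definition eigenvalue_list :: "real mat \<Rightarrow> real list" where
  "eigenvalue_list A = sorted_list_of_multiset (proots (char_poly A))"

definition nth_eigenvalue :: "real mat \<Rightarrow> nat \<Rightarrow> real" where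
  "nth_eigenvalue A i = eigenvalue_list A ! (i - 1)"

text \<open>The conjunct \<open>graph H\<close> makes \<open>H\<close> symmetric, i.e. an undirected subgraph.\<close>

definition k_factor :: "nat \<Rightarrow> ('a, 'b) pre_digraph \<Rightarrow> ('a, 'b) pre_digraph \<Rightarrow> bool" where
  "k_factor k H G \<longleftrightarrow> graph H \<and> spanning H G \<and> (\<forall>v \<in> verts H. out_degree H v = k)"

definition factor_critical :: "nat \<Rightarrow> nat \<Rightarrow> ('a, 'b) pre_digraph \<Rightarrow> bool" where
  "factor_critical k s G \<longleftrightarrow>
     (\<forall>X. X \<subseteq> verts G \<and> card X = s \<longrightarrow> (\<exists>H. k_factor k H (G \<restriction> (verts G - X))))"

end

theory Submission
  imports Defs "Jordan_Normal_Form.Schur_Decomposition" "HOL-Library.Disjoint_Sets"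
begin

text \<open>
  If \<open>G - X\<close> has no perfect matching, then by Tutte's theorem and parity some \<open>S\<close> splits
  \<open>G - X - S\<close> into \<open>c \<ge> |S| + 2\<close> mutually non-adjacent parts. Put \<open>T = X \<union> S\<close>; as \<open>s \<ge> 2\<close>,
  \<open>2|T| = 2(s + |S|) \<le> s c\<close>. On the other hand \<open>\<mu>\<^sub>2 (|T| + c) \<le> \<mu>\<^sub>n |T|\<close> (the toughness bound
  of Gu and Haemers), which gives \<open>\<mu>\<^sub>2 / \<mu>\<^sub>n \<le> s / (s + 2)\<close>.

  For the toughness bound, group the parts into two sides \<open>A\<close> and \<open>B\<close> with at least \<open>c / 2\<close>
  vertices each. Since no edge joins \<open>A\<close> to \<open>B\<close>, the functions \<open>1\<^sub>A + 1\<^sub>B\<close> and \<open>1\<^sub>A - 1\<^sub>B\<close> have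
  the same Dirichlet energy; bounding it above by \<open>\<mu>\<^sub>n\<close> for the first and below by \<open>\<mu>\<^sub>2\<close> for the
  second yields the claim. Such a grouping fails to exist only if \<open>c\<close> is odd and every part is a
  single vertex. Then the parts form an independent set \<open>C\<close>, and one averages the lower bound
  for \<open>1\<^sub>i - 1\<^sub>j\<close> over \<open>i \<noteq> j\<close> in \<open>C\<close> against the upper bound for \<open>1\<^sub>C\<close>.
\<close>

unbundle no funcset_syntax \<comment> \<open>its arrow clashes with the adjacency relation of digraphs\<close>

section \<open>Tutte's theorem\<close>

text \<open>Halmos-Vaughan induction. If a nonempty proper subfamily has exactly as many neighbours
  as members, it is matched inside its neighbourhood and the rest outside of it. Otherwise every
  nonempty proper subfamily has a neighbour to spare, so one pair can be fixed arbitrarily and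
  removed.\<close>

lemma hall:
  fixes N :: "'a \<Rightarrow> 'b set"
  assumes "finite F" and "\<And>C. C \<in> F \<Longrightarrow> finite (N C)"
    and "\<And>F'. F' \<subseteq> F \<Longrightarrow> card F' \<le> card (\<Union>(N ` F'))"
  shows "\<exists>h. inj_on h F \<and> (\<forall>C\<in>F. h C \<in> N C)"
  using assms
proof (induction "card F" arbitrary: F N rule: less_induct)
  case less
  note fin = less.prems(1) and finN = less.prems(2) and cond = less.prems(3)
  show ?case
  proof (cases "F = {}")
    case True
    then show ?thesis by auto
  next
    case False
    show ?thesis
    proof (cases "\<exists>K. K \<noteq> {} \<and> K \<subset> F \<and> card (\<Union>(N ` K)) = card K")
      case True
      then obtain K where K: "K \<noteq> {}" "K \<subset> F" "card (\<Union>(N ` K)) = card K" by blast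
      let ?NK = "\<Union>(N ` K)"
      have finK: "finite K" using K(2) fin finite_subset by blast
      have finNK: "finite ?NK" using finK K(2) finN by auto
      have "\<exists>h. inj_on h K \<and> (\<forall>C\<in>K. h C \<in> N C)"
        using K(2) finN cond finK by (intro less.hyps) (auto intro: psubset_card_mono[OF fin])
      then obtain h1 where h1: "inj_on h1 K" "\<And>C. C \<in> K \<Longrightarrow> h1 C \<in> N C" by blast
      have "\<exists>h. inj_on h (F - K) \<and> (\<forall>C\<in>F - K. h C \<in> N C - ?NK)"
      proof (rule less.hyps)
        show "card (F - K) < card F"
          using K(1,2) fin by (intro psubset_card_mono) auto
        show "finite (F - K)" using fin by auto
        show "finite (N C - ?NK)" if "C \<in> F - K" for C using that finN by auto
        fix F' assume F': "F' \<subseteq> F - K"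
        have finF': "finite F'" using F' fin finite_subset by blast
        \<comment> \<open>The condition for \<open>F' \<union> K\<close> transfers to
          \<open>F'\<close> with \<open>?NK\<close> removed, because \<open>K\<close> accounts for
          exactly \<open>card K\<close> of the neighbours.\<close>
        have "card F' + card K = card (F' \<union> K)"
          using F' finK finF' by (subst card_Un_disjoint) auto
        also have "\<dots> \<le> card (\<Union>(N ` (F' \<union> K)))"
          using F' K(2) by (intro cond) auto
        also have "\<Union>(N ` (F' \<union> K)) = (\<Union>C\<in>F'. N C - ?NK) \<union> ?NK" by auto
        also have "card \<dots> \<le> card (\<Union>C\<in>F'. N C - ?NK) + card ?NK"
          by (rule card_Un_le)
        finally show "card F' \<le> card (\<Union>C\<in>F'. N C - ?NK)" using K(3) by simp
      qed
      then obtain h2 where h2: "inj_on h2 (F - K)" "\<And>C. C \<in> F - K \<Longrightarrow> h2 C \<in> N C - ?NK" by blast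
      let ?h = "\<lambda>C. if C \<in> K then h1 C else h2 C"
      have "inj_on ?h F"
      proof (rule inj_onI)
        fix x y assume xy: "x \<in> F" "y \<in> F" "?h x = ?h y"
        consider "x \<in> K" "y \<in> K" | "x \<notin> K" "y \<notin> K" | "x \<in> K" "y \<notin> K" | "x \<notin> K" "y \<in> K" by blast
        then show "x = y"
        proof cases
          case 1 then show ?thesis using xy h1(1) by (auto dest: inj_onD)
        next
          case 2 then show ?thesis using xy h2(1) by (auto dest: inj_onD)
        next
          case 3 then show ?thesis using xy h1(2)[of x] h2(2)[of y] by auto
        next
          case 4 then show ?thesis using xy h1(2)[of y] h2(2)[of x] by auto
        qed
      qed
      moreover have "\<forall>C\<in>F. ?h C \<in> N C" using h1(2) h2(2) by auto
      ultimately show ?thesis by blast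
    next
      case nontight: False
      obtain C0 where C0: "C0 \<in> F" using False by blast
      have "N C0 \<noteq> {}" using cond[of "{C0}"] C0 by auto
      then obtain s where s: "s \<in> N C0" by blast
      have "\<exists>h. inj_on h (F - {C0}) \<and> (\<forall>C\<in>F - {C0}. h C \<in> N C - {s})"
      proof (rule less.hyps)
        show "card (F - {C0}) < card F" by (rule card_Diff1_less[OF fin C0])
        show "finite (F - {C0})" using fin by auto
        show "finite (N C - {s})" if "C \<in> F - {C0}" for C using that finN by auto
        fix F' assume F': "F' \<subseteq> F - {C0}"
        show "card F' \<le> card (\<Union>C\<in>F'. N C - {s})"
        proof (cases "F' = {}")
          case False
          \<comment> \<open>\<open>F'\<close> misses \<open>C0\<close>, so it is proper and hence
            not tight; its spare neighbour pays for the loss of \<open>s\<close>.\<close>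
          have "F' \<subset> F" using F' C0 by auto
          then have "card F' < card (\<Union>(N ` F'))"
            using nontight False cond[of F'] by (metis le_neq_implies_less psubset_imp_subset)
          moreover have "(\<Union>C\<in>F'. N C - {s}) = \<Union>(N ` F') - {s}" by auto
          moreover have "card (\<Union>(N ` F')) - 1 \<le> card (\<Union>(N ` F') - {s})"
            by (simp add: card_Diff_singleton_if)
          ultimately show ?thesis by simp
        qed simp
      qed
      then obtain h where h: "inj_on h (F - {C0})" "\<And>C. C \<in> F - {C0} \<Longrightarrow> h C \<in> N C - {s}" by blast
      let ?h = "h(C0 := s)"
      have "inj_on ?h (insert C0 (F - {C0}))"
        using h by (auto simp: inj_on_def)
      moreover have "\<forall>C\<in>F. ?h C \<in> N C" using h(2) s by auto
      ultimately show ?thesis using C0 by (auto simp: insert_absorb)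
    qed
  qed
qed

text \<open>
  A stand-in for sets of odd components of the graph induced on \<open>U\<close>: members are unions of
  components, so no notion of connectedness is needed.
\<close>

definition odd_parts :: "('a \<Rightarrow> 'a \<Rightarrow> bool) \<Rightarrow> 'a set \<Rightarrow> 'a set set \<Rightarrow> bool" where
  "odd_parts E U F \<longleftrightarrow> disjoint F \<and>
     (\<forall>C\<in>F. C \<subseteq> U \<and> odd (card C) \<and> (\<forall>x\<in>C. \<forall>y\<in>U. E x y \<longrightarrow> y \<in> C))"

text \<open>A perfect matching encoded as its partner involution; for irreflexive \<open>E\<close>
  there are no fixed points.\<close>

definition matching_fun :: "('a \<Rightarrow> 'a \<Rightarrow> bool) \<Rightarrow> 'a set \<Rightarrow> ('a \<Rightarrow> 'a) \<Rightarrow> bool" where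
  "matching_fun E V m \<longleftrightarrow> (\<forall>v\<in>V. m v \<in> V \<and> m (m v) = v \<and> E v (m v))"

section \<open>Parity and extension of families of odd parts\<close>

lemma odd_parts_finite:
  assumes "odd_parts E U F" "finite U"
  shows "finite F"
  using assms finite_subset[of F "Pow U"] by (auto simp: odd_parts_def)

lemma odd_parts_parity:
  assumes "odd_parts E U F" "finite U"
  shows "even (card U) \<longleftrightarrow> even (card F + card (U - \<Union>F))"
proof -
  have finF: "finite F" using assms odd_parts_finite by blast
  have sub: "\<Union>F \<subseteq> U" using assms by (auto simp: odd_parts_def)
  have "card (\<Union>F) = (\<Sum>C\<in>F. card C)"
    using assms by (intro card_Union_disjoint) (auto simp: odd_parts_def intro: finite_subset[of _ U])
  moreover have "{C \<in> F. odd (card C)} = F" using assms by (auto simp: odd_parts_def)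
  ultimately have "even (card (\<Union>F)) \<longleftrightarrow> even (card F)"
    using even_sum_iff[OF finF, of card] by simp
  moreover have "card U = card (\<Union>F) + card (U - \<Union>F)"
    using sub assms(2) by (metis card_Diff_subset card_mono finite_subset le_add_diff_inverse)
  ultimately show ?thesis by simp
qed

text \<open>Closedness of \<open>R\<close> is required only within the uncovered rest: the members
  of \<open>F\<close> are closed, so by symmetry of \<open>E\<close> no edge leads from
  \<open>R\<close> into them.\<close>

lemma odd_parts_insert_rest:
  assumes "symp E" "odd_parts E U F" "finite U" "odd (card R)" "R \<subseteq> U - \<Union>F"
    and "\<And>x y. x \<in> R \<Longrightarrow> y \<in> U - \<Union>F \<Longrightarrow> E x y \<Longrightarrow> y \<in> R"
  shows "odd_parts E U (insert R F)" "card (insert R F) = Suc (card F)"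
proof -
  have "R \<noteq> {}" using assms(4) by auto
  then have "R \<notin> F" using assms(5) by auto
  then show "card (insert R F) = Suc (card F)"
    using odd_parts_finite[OF assms(2,3)] by simp
  have "y \<in> R" if xy: "x \<in> R" "y \<in> U" "E x y" for x y
  proof (rule assms(6)[OF xy(1) _ xy(3)])
    have "x \<notin> C \<and> x \<in> U" if "C \<in> F" for C using assms(5) xy(1) that by auto
    moreover have "E y x" using xy(3) assms(1) by (auto dest: sympD)
    ultimately show "y \<in> U - \<Union>F" using xy(2) assms(2) unfolding odd_parts_def by blast
  qed
  then show "odd_parts E U (insert R F)"
    using assms(2,4,5) by (auto simp: odd_parts_def disjoint_def pairwise_insert disjnt_def)
qed

text \<open>As \<open>card V\<close> is even, an excess of exactly one forces the uncovered rest to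
  have odd size, and then it serves as a further part.\<close>

lemma odd_parts_excess_two:
  assumes "symp E" "finite V" "even (card V)" "S \<subseteq> V" "odd_parts E (V - S) F" "card S < card F"
  obtains F' where "odd_parts E (V - S) F'" "card S + 2 \<le> card F'"
proof (cases "card S + 2 \<le> card F")
  case True
  then show ?thesis using assms(5) that by blast
next
  case False
  then have F: "card F = Suc (card S)" using assms(6) by simp
  let ?R = "V - S - \<Union>F"
  have "card V = card S + card (V - S)"
    using assms(2,4) by (metis card_Diff_subset card_mono finite_subset le_add_diff_inverse)
  then have "even (card S + card (V - S))" using assms(3) by simp
  then have "odd (card ?R)"
    using odd_parts_parity[OF assms(5)] assms(2) F by auto
  from odd_parts_insert_rest[OF assms(1,5) _ this] show ?thesis
    using that[of "insert ?R F"] F assms(2) by auto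
qed

text \<open>The sufficiency half. The hypothesis is equivalent to Tutte's condition on odd
  components, since a union of components of odd size contains an odd component.\<close>

theorem tutte:
  fixes E :: "'a \<Rightarrow> 'a \<Rightarrow> bool"
  assumes "symp E" "finite V"
    and "\<And>S F. S \<subseteq> V \<Longrightarrow> odd_parts E (V - S) F \<Longrightarrow> card F \<le> card S"
  shows "\<exists>m. matching_fun E V m"
  using assms(2,3)
proof (induction "card V" arbitrary: V rule: less_induct)
  case less
  note finV = less.prems(1) and cond = less.prems(2)
  show ?case
  proof (cases "V = {}")
    case True
    then show ?thesis by (auto simp: matching_fun_def)
  next
    case False
    then obtain v0 where v0: "v0 \<in> V" by blast
    \<comment> \<open>If \<open>card V\<close> were odd, \<open>V\<close> itself would be an odd
      part for the empty deletion set.\<close>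
    have evenV: "even (card V)"
      using cond[of "{}" "{V}"] by (auto simp: odd_parts_def)
    \<comment> \<open>Anderson's argument: for a maximal tight \<open>S\<close>, deleting any vertex from an odd part leaves a
      set with a perfect matching, and Hall's theorem matches the parts with \<open>S\<close>.\<close>
    define tight where "tight S \<longleftrightarrow> S \<subseteq> V \<and> (\<exists>F. odd_parts E (V - S) F \<and> card F = card S)" for S
    have tight_bound: "card S \<le> card V" if "tight S" for S
      using that card_mono[OF finV] by (auto simp: tight_def)
    \<comment> \<open>The singleton of \<open>v0\<close> is tight, with all remaining vertices as
      its one odd part. Hence a tight set of maximal size exists and is nonempty.\<close>
    have "odd (card (V - {v0}))" using v0 finV evenV
      by (metis False card_gt_0_iff even_Suc card_Suc_Diff1)
    then have tight_v0: "tight {v0}"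
      using v0 by (auto simp: tight_def odd_parts_def intro!: exI[of _ "{V - {v0}}"])
    obtain S where S: "tight S" and S_max: "\<And>S'. tight S' \<Longrightarrow> card S' \<le> card S"
      using ex_has_greatest_nat[of tight "{v0}" card "Suc (card V)"] tight_v0 tight_bound
      by (auto simp: less_Suc_eq_le)
    obtain F where SV: "S \<subseteq> V" and F: "odd_parts E (V - S) F" and card_F: "card F = card S"
      using S by (auto simp: tight_def)
    have finS: "finite S" using SV finV finite_subset by blast
    have finF: "finite F" using F finV odd_parts_finite by blast
    have S_ne: "S \<noteq> {}" using S_max[OF tight_v0] by auto
    have not_tight: False
      if "S' \<subseteq> V" "odd_parts E (V - S') F'" "card S' \<le> card F'" "card S < card S'" for S' F'
    proof -
      have "card F' = card S'" using cond[OF that(1,2)] that(3) by simp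
      then have "tight S'" using that(1,2) by (auto simp: tight_def)
      then show False using S_max that(4) by fastforce
    qed
    \<comment> \<open>An uncovered rest has even size by parity. Moving one of its vertices into
      \<open>S\<close> would make the remainder an additional odd part, giving a larger tight
      set.\<close>
    have cover: "\<Union>F = V - S"
    proof (rule ccontr)
      let ?R = "V - S - \<Union>F"
      assume "\<Union>F \<noteq> V - S"
      moreover have "\<Union>F \<subseteq> V - S" using F by (auto simp: odd_parts_def)
      ultimately obtain v where v: "v \<in> ?R" by blast
      have finR: "finite ?R" using finV by auto
      have "card V = card S + card (V - S)"
        using finV SV by (metis card_Diff_subset card_mono finite_subset le_add_diff_inverse)
      then have "even (card ?R)"
        using odd_parts_parity[OF F] finV evenV card_F by auto
      then have odd: "odd (card (?R - {v}))"
        using card_Suc_Diff1[OF finR v] by (metis even_Suc)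
      have F': "odd_parts E (V - insert v S) F"
        using F v by (auto simp: odd_parts_def)
      have R': "?R - {v} \<subseteq> V - insert v S - \<Union>F" by auto
      have closed: "y \<in> ?R - {v}" if "y \<in> V - insert v S - \<Union>F" for y using that by auto
      have "finite (V - insert v S)" using finV by auto
      note ins = odd_parts_insert_rest[OF assms(1) F' this odd R' closed]
      have "odd_parts E (V - insert v S) (insert (?R - {v}) F)" by (rule ins(1))
      moreover have "card (insert (?R - {v}) F) = Suc (card F)" by (rule ins(2))
      ultimately show False
        using not_tight[of "insert v S" "insert (?R - {v}) F"] v SV finS card_F by auto
    qed
    \<comment> \<open>By the induction hypothesis only Tutte's condition is to be checked. A
      violation inside \<open>C - {v}\<close> has excess at least two by parity, and refining
      \<open>C\<close> by it enlarges \<open>S\<close> to another tight set.\<close>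
    have sub: "\<exists>m. matching_fun E (C - {v}) m" if C: "C \<in> F" and v: "v \<in> C" for C v
    proof (rule less.hyps)
      have CV: "C \<subseteq> V - S" and oddC: "odd (card C)"
        and closed: "\<And>x y. x \<in> C \<Longrightarrow> y \<in> V - S \<Longrightarrow> E x y \<Longrightarrow> y \<in> C"
        using C F by (auto simp: odd_parts_def)
      have finC: "finite C" using CV finV finite_subset by blast
      show "card (C - {v}) < card V" using CV v finV by (intro psubset_card_mono) auto
      show "finite (C - {v})" using finC by auto
      have even: "even (card (C - {v}))" using oddC card_Suc_Diff1[OF finC v] by (metis even_Suc)
      fix S' F' assume S': "S' \<subseteq> C - {v}" and F': "odd_parts E (C - {v} - S') F'"
      show "card F' \<le> card S'"
      proof (rule ccontr)
        assume "\<not> card F' \<le> card S'"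
        then obtain F'' where F'': "odd_parts E (C - {v} - S') F''" "card S' + 2 \<le> card F''"
          using odd_parts_excess_two[OF assms(1) _ even S' F'] finC by force
        have finS': "finite S'" using S' finC finite_subset by blast
        have finF'': "finite F''" using F''(1) finC odd_parts_finite by blast
        \<comment> \<open>The deletion set grows by \<open>1 + card S'\<close>. The family loses
          \<open>C\<close> and gains at least \<open>card S' + 2\<close> parts, so the two sizes
          still balance.\<close>
        let ?S = "insert v S \<union> S'" and ?F = "(F - {C}) \<union> F''"
        have S'_S: "S' \<inter> S = {}" "v \<notin> S" "v \<notin> S'" using S' CV v by auto
        have card_S: "card ?S = Suc (card S + card S')"
          using S'_S finS finS' by (simp add: card_Un_disjoint Int_commute)
        have D_C: "D \<inter> C = {}" if "D \<in> F - {C}" for D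
          using that C F by (auto simp: odd_parts_def disjoint_def)
        have D_sub: "D \<subseteq> C" "D \<noteq> {}" if "D \<in> F''" for D
          using that F''(1) by (auto simp: odd_parts_def)
        have "(F - {C}) \<inter> F'' = {}" using D_C D_sub by fastforce
        then have "card ?F = card (F - {C}) + card F''"
          using finF finF'' by (simp add: card_Un_disjoint)
        then have "card ?S \<le> card ?F"
          using card_S F''(2) card_F C finF card_Suc_Diff1[OF finF C] by simp
        moreover have "odd_parts E (V - ?S) ?F"
        proof -
          have dis: "disjoint ?F"
          proof (rule disjoint_union)
            show "disjoint (F - {C})" using F by (auto simp: odd_parts_def intro: pairwise_subset)
            show "disjoint F''" using F''(1) by (simp add: odd_parts_def)
            show "\<Union>(F - {C}) \<inter> \<Union>F'' = {}" using D_C D_sub(1) by blast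
          qed
          have "D \<subseteq> V - ?S \<and> odd (card D) \<and> (\<forall>x\<in>D. \<forall>y\<in>V - ?S. E x y \<longrightarrow> y \<in> D)" if "D \<in> F - {C}" for D
          proof -
            have "D \<subseteq> V - S" "odd (card D)" "\<forall>x\<in>D. \<forall>y\<in>V - S. E x y \<longrightarrow> y \<in> D"
              using that F by (auto simp: odd_parts_def)
            then show ?thesis using D_C[OF that] S' v by blast
          qed
          moreover have "D \<subseteq> V - ?S \<and> odd (card D) \<and> (\<forall>x\<in>D. \<forall>y\<in>V - ?S. E x y \<longrightarrow> y \<in> D)" if "D \<in> F''" for D
          proof -
            have D: "D \<subseteq> C - {v} - S'" "odd (card D)" "\<forall>x\<in>D. \<forall>y\<in>C - {v} - S'. E x y \<longrightarrow> y \<in> D"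
              using that F''(1) by (auto simp: odd_parts_def)
            moreover have "y \<in> D" if "x \<in> D" "y \<in> V - ?S" "E x y" for x y
              using closed[of x y] D that by blast
            ultimately show ?thesis using CV by blast
          qed
          ultimately have "\<forall>D\<in>?F. D \<subseteq> V - ?S \<and> odd (card D) \<and> (\<forall>x\<in>D. \<forall>y\<in>V - ?S. E x y \<longrightarrow> y \<in> D)"
            by (rule ball_Un[THEN iffD2, OF conjI, OF ballI ballI])
          then show ?thesis using dis unfolding odd_parts_def by (intro conjI)
        qed
        ultimately show False
          using not_tight[of ?S ?F] card_S SV CV S' v by auto
      qed
    qed
    define N where "N C = {s \<in> S. \<exists>x\<in>C. E s x}" for C
    have "\<exists>h. inj_on h F \<and> (\<forall>C\<in>F. h C \<in> N C)"
    proof (rule hall[OF finF])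
      show "finite (N C)" for C using finS by (auto simp: N_def)
      fix F' assume F': "F' \<subseteq> F"
      have "odd_parts E (V - \<Union>(N ` F')) F'"
        unfolding odd_parts_def
      proof (intro conjI ballI impI)
        show "disjoint F'" using F' F by (auto simp: odd_parts_def intro: pairwise_subset)
        fix C assume C: "C \<in> F'"
        show "C \<subseteq> V - \<Union>(N ` F')" "odd (card C)"
          using C F' F by (auto simp: odd_parts_def N_def)
        fix x y assume xy: "x \<in> C" "y \<in> V - \<Union>(N ` F')" "E x y"
        have "y \<notin> S" using xy C assms(1) by (auto simp: N_def dest: sympD)
        then show "y \<in> C" using xy C F' F by (auto simp: odd_parts_def)
      qed
      moreover have "\<Union>(N ` F') \<subseteq> V" using SV by (auto simp: N_def)
      ultimately show "card F' \<le> card (\<Union>(N ` F'))" using cond by blast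
    qed
    then obtain h where h_inj: "inj_on h F" and h: "\<And>C. C \<in> F \<Longrightarrow> h C \<in> N C" by blast
    have h_im: "h ` F = S"
      using h h_inj card_F finS by (intro card_subset_eq) (auto simp: N_def card_image)
    have "\<forall>C\<in>F. \<exists>x\<in>C. E (h C) x" using h by (auto simp: N_def)
    then obtain p where p: "\<And>C. C \<in> F \<Longrightarrow> p C \<in> C" "\<And>C. C \<in> F \<Longrightarrow> E (h C) (p C)" by metis
    have "\<forall>C\<in>F. \<exists>m. matching_fun E (C - {p C}) m" using sub p(1) by blast
    then obtain m where m: "\<And>C. C \<in> F \<Longrightarrow> matching_fun E (C - {p C}) (m C)" by metis
    define part where "part x = (THE C. C \<in> F \<and> x \<in> C)" for x
    have part: "part x = C" if "C \<in> F" "x \<in> C" for x C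
    proof -
      have "D = C" if "D \<in> F" "x \<in> D" for D
        using F that \<open>C \<in> F\<close> \<open>x \<in> C\<close> by (fastforce simp: odd_parts_def disjoint_def)
      then show ?thesis unfolding part_def using that by (intro the_equality) blast+
    qed
    \<comment> \<open>Each vertex of \<open>S\<close> is paired with the chosen neighbour
      \<open>p C\<close> in the part \<open>C\<close> that \<open>h\<close> assigns to it; the rest
      of \<open>C\<close> follows its own matching \<open>m C\<close>.\<close>
    define g where "g x = (if x \<in> S then p (inv_into F h x)
      else if x = p (part x) then h (part x) else m (part x) x)" for x
    have "g x \<in> V \<and> g (g x) = x \<and> E x (g x)" if x: "x \<in> V" for x
    proof (cases "x \<in> S")
      case True
      then obtain C where C: "C \<in> F" "x = h C" using h_im by auto
      have "g x = p C" using True C h_inj by (simp add: g_def)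
      moreover have "p C \<in> V - S" using p(1)[OF C(1)] C(1) cover by auto
      moreover have "part (p C) = C" using part C(1) p(1) by blast
      ultimately show ?thesis using C p by (simp add: g_def)
    next
      case False
      then obtain C where C: "C \<in> F" "x \<in> C" using x cover by auto
      have pC: "part x = C" using part C by blast
      show ?thesis
      proof (cases "x = p C")
        case True
        have hC: "h C \<in> S" using C h_im by auto
        have "g x = h C" using True False pC by (simp add: g_def)
        moreover have "g (h C) = p C" using hC C h_inj by (simp add: g_def)
        moreover have "E x (h C)" using p(2)[OF C(1)] True assms(1) by (auto dest: sympD)
        ultimately show ?thesis using hC SV True by auto
      next
        case neq: False
        have gx: "g x = m C x" using neq False pC by (simp add: g_def)
        have mm: "m C x \<in> C - {p C}" "m C (m C x) = x" "E x (m C x)"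
          using m[OF C(1)] C(2) neq by (auto simp: matching_fun_def)
        have "m C x \<in> V - S" using mm(1) C(1) cover by auto
        moreover have "part (m C x) = C" using part[OF C(1)] mm(1) by auto
        ultimately have "g (m C x) = x" using mm by (simp add: g_def)
        then show ?thesis using gx mm \<open>m C x \<in> V - S\<close> by auto
      qed
    qed
    then show ?thesis unfolding matching_fun_def by blast
  qed
qed

section \<open>Diagonalization of real symmetric matrices\<close>

lemma conjugate_real_vec: "conjugate v = (v :: real vec)"
  by (rule eq_vecI) auto

text \<open>Over the complex numbers an eigenvalue exists. Symmetry of the real matrix forces it to
  be real, so it is a root of the real characteristic polynomial and has a real eigenvector.\<close>

lemma real_symmetric_eigenvalue:
  fixes A :: "real mat"
  assumes A: "A \<in> carrier_mat n n" and sym: "transpose_mat A = A" and n: "n > 0"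
  shows "\<exists>e v. v \<in> carrier_vec n \<and> v \<noteq> 0\<^sub>v n \<and> A *\<^sub>v v = e \<cdot>\<^sub>v v"
proof -
  let ?A = "map_mat complex_of_real A"
  have cA: "?A \<in> carrier_mat n n" using A by auto
  obtain as where as: "char_poly ?A = (\<Prod>a\<leftarrow>as. [:- a, 1:])" "length as = n"
    using char_poly_factorized[OF cA] by blast
  then obtain a where "a \<in> set as" using n by (cases as) auto
  then have root: "poly (char_poly ?A) a = 0"
    unfolding as(1) by (auto simp: poly_prod_list prod_list_zero_iff)
  then obtain z where z: "z \<in> carrier_vec n" "z \<noteq> 0\<^sub>v n" "?A *\<^sub>v z = a \<cdot>\<^sub>v z"
    using eigenvalue_root_char_poly[OF cA, of a] cA unfolding eigenvalue_def eigenvector_def by auto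
  have conjA: "conjugate (?A *\<^sub>v z) = ?A *\<^sub>v conjugate z"
    by (rule eq_vecI) (use A z(1) in \<open>auto simp: scalar_prod_def sum_conjugate conjugate_dist_mul\<close>)
  have symA: "transpose_mat ?A = ?A" by (subst (2) sym[symmetric]) auto
  \<comment> \<open>Moving the matrix to the other side of the Hermitian product replaces
    \<open>a\<close> by \<open>cnj a\<close>.\<close>
  have "a * (z \<bullet>c z) = (?A *\<^sub>v z) \<bullet>c z" using z by simp
  also have "\<dots> = (transpose_mat ?A *\<^sub>v z) \<bullet> conjugate z" by (simp add: symA)
  also have "\<dots> = z \<bullet> (?A *\<^sub>v conjugate z)"
    using z(1) cA by (intro transpose_vec_mult_scalar) auto
  also have "\<dots> = z \<bullet>c (a \<cdot>\<^sub>v z)" unfolding conjA[symmetric] z(3) ..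
  also have "\<dots> = cnj a * (z \<bullet>c z)" using z(1) by (simp add: conjugate_smult_vec)
  finally have "a = cnj a" using z by (simp add: conjugate_square_eq_0_vec[OF z(1)])
  then have "a \<in> \<real>" by (simp add: Reals_cnj_iff)
  then obtain e where e: "a = complex_of_real e" by (auto elim: Reals_cases)
  have "complex_of_real (poly (char_poly A) e) = 0"
    using root unfolding e of_real_hom.char_poly_hom[OF A] by simp
  then have "eigenvalue A e" using eigenvalue_root_char_poly[OF A] by simp
  then show ?thesis using A unfolding eigenvalue_def eigenvector_def by auto
qed

text \<open>Gram-Schmidt applied to a basis that starts with \<open>v\<close> leaves the first
  vector unchanged; normalizing the result only rescales it.\<close>

lemma orthogonal_mat_first_col:
  fixes v :: "real vec"
  assumes v: "v \<in> carrier_vec n" "v \<noteq> 0\<^sub>v n"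
  shows "\<exists>W\<in>carrier_mat n n. \<exists>c. transpose_mat W * W = 1\<^sub>m n \<and> col W 0 = c \<cdot>\<^sub>v v"
proof -
  interpret cof_vec_space n "TYPE(real)" .
  let ?b = "basis_completion v"
  define us where "us = gram_schmidt n ?b"
  note b = basis_completion[OF v]
  have us: "set us \<subseteq> carrier_vec n" "corthogonal us" "length us = n"
    using gram_schmidt_result[OF b(2,4,5) us_def] b(6) by auto
  have n: "n > 0" using v by (cases n) auto
  have hd: "us ! 0 = v"
  proof -
    obtain vs where "?b = v # vs" using b(6,7) n by (cases ?b) auto
    then have "hd us = v" using gram_schmidt_hd[OF v(1)] us_def by simp
    then show ?thesis using us(3) n by (metis hd_conv_nth length_greater_0_conv)
  qed
  have usi: "us ! i \<in> carrier_vec n" if "i < n" for i using us that by auto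
  have orth: "us ! i \<bullet> us ! j = 0 \<longleftrightarrow> i \<noteq> j" if "i < n" "j < n" for i j
    using corthogonalD[OF us(2)] us(3) that by (simp add: conjugate_real_vec)
  define c where "c i = 1 / sqrt (us ! i \<bullet> us ! i)" for i
  define W where "W = mat_of_cols n (map (\<lambda>i. c i \<cdot>\<^sub>v us ! i) [0..<n])"
  have W: "W \<in> carrier_mat n n"
    using mat_of_cols_carrier(1)[of n "map (\<lambda>i. c i \<cdot>\<^sub>v us ! i) [0..<n]"] by (simp add: W_def)
  have col: "col W i = c i \<cdot>\<^sub>v us ! i" if "i < n" for i
    using that usi unfolding W_def by (subst col_mat_of_cols) auto
  have "transpose_mat W * W = 1\<^sub>m n"
  proof (rule eq_matI)
    fix i j assume "i < dim_row (1\<^sub>m n :: real mat)" "j < dim_col (1\<^sub>m n :: real mat)"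
    then have ij: "i < n" "j < n" by auto
    have "(transpose_mat W * W) $$ (i, j) = col W i \<bullet> col W j" using W ij by simp
    also have "\<dots> = c i * c j * (us ! i \<bullet> us ! j)" using usi[OF ij(1)] usi[OF ij(2)] ij by (simp add: col)
    also have "\<dots> = (if i = j then 1 else 0)"
    proof (cases "i = j")
      case True
      have "us ! i \<bullet> us ! i \<ge> 0" using usi[OF ij(1)] by (simp add: scalar_prod_def sum_nonneg)
      moreover have "us ! i \<bullet> us ! i \<noteq> 0" using orth ij by blast
      ultimately show ?thesis using True by (simp add: c_def)
    qed (use orth ij in auto)
    finally show "(transpose_mat W * W) $$ (i, j) = 1\<^sub>m n $$ (i, j)" using ij by simp
  qed (use W in auto)
  then show ?thesis using W col[OF n] hd by auto
qed

text \<open>Deflation: in an orthonormal basis starting with an eigenvector, symmetry clears the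
  first row and column off the diagonal, and the induction hypothesis diagonalizes the remaining
  block.\<close>

theorem real_symmetric_diagonalization:
  fixes A :: "real mat"
  assumes "A \<in> carrier_mat n n" and "transpose_mat A = A"
  shows "\<exists>U\<in>carrier_mat n n. transpose_mat U * U = 1\<^sub>m n \<and> diagonal_mat (transpose_mat U * A * U)"
  using assms
proof (induction n arbitrary: A)
  case 0
  then show ?case by (intro bexI[of _ "1\<^sub>m 0"]) (auto simp: diagonal_mat_def)
next
  case (Suc n)
  note A = Suc.prems(1) and sym = Suc.prems(2)
  let ?N = "Suc n"
  obtain e v where v: "v \<in> carrier_vec ?N" "v \<noteq> 0\<^sub>v ?N" "A *\<^sub>v v = e \<cdot>\<^sub>v v"
    using real_symmetric_eigenvalue[OF A sym] by auto
  obtain W c where W: "W \<in> carrier_mat ?N ?N" and WW: "transpose_mat W * W = 1\<^sub>m ?N"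
    and c: "col W 0 = c \<cdot>\<^sub>v v"
    using orthogonal_mat_first_col[OF v(1,2)] by auto
  define B where "B = transpose_mat W * A * W"
  have B: "B \<in> carrier_mat ?N ?N" using A W by (simp add: B_def)
  have symB: "transpose_mat B = B"
    using A W sym by (simp add: B_def transpose_mult[of _ ?N ?N _ ?N] assoc_mult_mat[of _ ?N ?N _ ?N _ ?N])
  have AW: "A *\<^sub>v col W 0 = e \<cdot>\<^sub>v col W 0"
    unfolding c using A v by (simp add: mult_mat_vec smult_smult_assoc mult.commute)
  have colB: "B $$ (i, 0) = (if i = 0 then e else 0)" if i: "i < ?N" for i
  proof -
    have "B $$ (i, 0) = (transpose_mat W * (A * W)) $$ (i, 0)"
      using A W by (simp add: B_def assoc_mult_mat[of _ ?N ?N _ ?N _ ?N])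
    also have "\<dots> = col W i \<bullet> (A *\<^sub>v col W 0)" using A W i by (simp add: mult_mat_vec_def)
    also have "\<dots> = e * (col W i \<bullet> col W 0)" unfolding AW using W i by simp
    also have "col W i \<bullet> col W 0 = (transpose_mat W * W) $$ (i, 0)" using W i by simp
    finally show ?thesis unfolding WW using i by simp
  qed
  have rowB: "B $$ (0, i) = (if i = 0 then e else 0)" if i: "i < ?N" for i
    using colB[OF i] B i by (subst symB[symmetric]) simp
  define A3 where "A3 = mat n n (\<lambda>(i, j). B $$ (Suc i, Suc j))"
  define A1 where "A1 = mat 1 1 (\<lambda>_. e)"
  have A3: "A3 \<in> carrier_mat n n" and A1: "A1 \<in> carrier_mat 1 1" by (auto simp: A3_def A1_def)
  have blockB: "B = four_block_mat A1 (0\<^sub>m 1 n) (0\<^sub>m n 1) A3"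
    by (rule eq_matI) (use B colB rowB in \<open>auto simp: A1_def A3_def\<close>)
  have "transpose_mat A3 = A3"
  proof (rule eq_matI)
    fix i j assume "i < dim_row A3" "j < dim_col A3"
    then have ij: "i < n" "j < n" by (auto simp: A3_def)
    have "B $$ (Suc j, Suc i) = transpose_mat B $$ (Suc j, Suc i)" by (simp add: symB)
    also have "\<dots> = B $$ (Suc i, Suc j)" using B ij by simp
    finally show "transpose_mat A3 $$ (i, j) = A3 $$ (i, j)" using ij by (simp add: A3_def)
  qed (auto simp: A3_def)
  then obtain V where V: "V \<in> carrier_mat n n" and VV: "transpose_mat V * V = 1\<^sub>m n"
    and diag: "diagonal_mat (transpose_mat V * A3 * V)"
    using Suc.IH[OF A3] by auto
  \<comment> \<open>The orthogonal matrix for the smaller block is extended by an identity entry, so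
    that it fixes the eigenvector already split off.\<close>
  define X where "X = four_block_mat (1\<^sub>m 1) (0\<^sub>m 1 n) (0\<^sub>m n 1) V"
  have X: "X \<in> carrier_mat ?N ?N" using V by (auto simp: X_def)
  have Xt: "transpose_mat X = four_block_mat (1\<^sub>m 1) (0\<^sub>m 1 n) (0\<^sub>m n 1) (transpose_mat V)"
    unfolding X_def using V by (subst transpose_four_block_mat[of _ 1 1 _ n _ n]) auto
  have XX: "transpose_mat X * X = 1\<^sub>m ?N"
  proof -
    have "transpose_mat X * X = four_block_mat (1\<^sub>m 1) (0\<^sub>m 1 n) (0\<^sub>m n 1) (1\<^sub>m n)"
      unfolding Xt unfolding X_def using V VV
      by (subst mult_four_block_mat[of _ 1 1 _ n _ n _ _ 1 _ n]) auto
    also have "\<dots> = 1\<^sub>m ?N" by (rule eq_matI) auto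
    finally show ?thesis .
  qed
  have XBX: "transpose_mat X * B * X = four_block_mat A1 (0\<^sub>m 1 n) (0\<^sub>m n 1) (transpose_mat V * A3 * V)"
    unfolding Xt blockB unfolding X_def using V A1 A3
    by (simp add: mult_four_block_mat[of _ 1 1 _ n _ n _ _ 1 _ n])
  let ?U = "W * X"
  have U: "?U \<in> carrier_mat ?N ?N" using W X by simp
  have "transpose_mat ?U * ?U = transpose_mat X * (transpose_mat W * W) * X"
    using W X by (simp add: transpose_mult[of _ ?N ?N _ ?N] assoc_mult_mat[of _ ?N ?N _ ?N _ ?N])
  then have UU: "transpose_mat ?U * ?U = 1\<^sub>m ?N" using X XX by (simp add: WW)
  have "transpose_mat ?U * A * ?U = transpose_mat X * B * X"
    unfolding B_def
    using A W X by (simp add: transpose_mult[of _ ?N ?N _ ?N] assoc_mult_mat[of _ ?N ?N _ ?N _ ?N])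
  moreover have "diagonal_mat (transpose_mat X * B * X)"
    unfolding XBX using diag A1 V A3 by (auto simp: diagonal_mat_def)
  ultimately show ?case using U UU by metis
qed

section \<open>Ordered eigenvalues and Rayleigh bounds\<close>

lemma char_poly_orthogonal_diagonal:
  fixes A :: "real mat"
  assumes A: "A \<in> carrier_mat n n" and U: "U \<in> carrier_mat n n" "transpose_mat U * U = 1\<^sub>m n"
    and diag: "diagonal_mat (transpose_mat U * A * U)"
  shows "char_poly A = (\<Prod>a\<leftarrow>diag_mat (transpose_mat U * A * U). [:- a, 1:])"
proof -
  let ?D = "transpose_mat U * A * U"
  have D: "?D \<in> carrier_mat n n" using A U by simp
  have UU: "U * transpose_mat U = 1\<^sub>m n"
    using U mat_mult_left_right_inverse[of "transpose_mat U" n U] by simp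
  have "similar_mat_wit ?D A (transpose_mat U) U"
    by (rule similar_mat_witI[of _ _ n]) (use A U UU in auto)
  then have "char_poly ?D = char_poly A"
    by (intro char_poly_similar) (auto simp: similar_mat_def)
  moreover have "upper_triangular ?D" using diag D by (auto simp: diagonal_mat_def)
  ultimately show ?thesis using char_poly_upper_triangular[OF D] by simp
qed

lemma proots_linear_factors:
  fixes es :: "'a::idom list"
  shows "proots (\<Prod>a\<leftarrow>es. [:- a, 1:]) = mset es"
proof (induction es)
  case (Cons a es)
  have "(\<Prod>a\<leftarrow>es. [:- a, 1:]) \<noteq> 0" by (auto simp: prod_list_zero_iff)
  then show ?case using Cons by (simp add: proots_mult del: mult_pCons_left)
qed simp

text \<open>\<open>k\<close> is the position that the sorting permutation assigns to the smallest
  entry. All other entries sit at sorted index 1 or later, counting from 0.\<close>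

lemma nth_sort_Suc_0_le:
  fixes xs :: "'a::linorder list"
  assumes "2 \<le> length xs"
  obtains k where "k < length xs" "\<And>j. j < length xs \<Longrightarrow> j \<noteq> k \<Longrightarrow> sort xs ! 1 \<le> xs ! j"
proof -
  obtain p where p: "p permutes {..<length xs}" "permute_list p xs = sort xs"
    using mset_eq_permutation[of "sort xs" xs] by auto
  have "sort xs ! 1 \<le> xs ! j" if j: "j < length xs" "j \<noteq> p 0" for j
  proof -
    obtain i where i: "j = p i" "i < length xs"
      using p(1) j(1) by (metis lessThan_iff permutes_in_image permutes_surj surjD)
    then have "i \<noteq> 0" using j(2) by metis
    have "sort xs ! i = xs ! j"
      using p i by (metis permute_list_nth)
    moreover have "sort xs ! 1 \<le> sort xs ! i"
      using \<open>i \<noteq> 0\<close> i(2) by (intro sorted_nth_mono) auto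
    ultimately show ?thesis by simp
  qed
  moreover have "p 0 < length xs"
    using p(1) assms by (metis lessThan_iff less_le_trans permutes_in_image zero_less_numeral)
  ultimately show ?thesis using that by blast
qed

lemma nth_le_sort_last:
  fixes xs :: "'a::linorder list"
  assumes "j < length xs"
  shows "xs ! j \<le> sort xs ! (length xs - 1)"
proof -
  have "xs ! j \<in> set (sort xs)" using assms by simp
  then obtain i where i: "i < length xs" "xs ! j = sort xs ! i"
    by (metis in_set_conv_nth length_sort)
  then show ?thesis by (simp add: sorted_nth_mono)
qed

text \<open>In eigenvector coordinates the form is a weighted sum of squares, which gives the upper
  bound. For the lower bound, positivity of the second eigenvalue makes the kernel the line of
  \<open>w\<close>, so a vector orthogonal to \<open>w\<close> has no component along the one
  eigenvector whose eigenvalue may be smaller.\<close>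

lemma rayleigh_bounds:
  fixes A :: "real mat"
  assumes A: "A \<in> carrier_mat n n" and sym: "transpose_mat A = A" and n: "2 \<le> n"
    and w: "w \<in> carrier_vec n" "w \<noteq> 0\<^sub>v n" "A *\<^sub>v w = 0\<^sub>v n"
    and x: "x \<in> carrier_vec n" "w \<bullet> x = 0"
  shows "x \<bullet> (A *\<^sub>v x) \<le> nth_eigenvalue A n * (x \<bullet> x)"
    and "nth_eigenvalue A 2 > 0 \<Longrightarrow> nth_eigenvalue A 2 * (x \<bullet> x) \<le> x \<bullet> (A *\<^sub>v x)"
proof -
  obtain U where U: "U \<in> carrier_mat n n" "transpose_mat U * U = 1\<^sub>m n"
    and diag: "diagonal_mat (transpose_mat U * A * U)"
    using real_symmetric_diagonalization[OF A sym] by blast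
  define D where "D = transpose_mat U * A * U"
  have D: "D \<in> carrier_mat n n" using A U by (simp add: D_def)
  have UU: "U * transpose_mat U = 1\<^sub>m n"
    using U mat_mult_left_right_inverse[of "transpose_mat U" n U] by simp
  have ev: "eigenvalue_list A = sort (diag_mat D)"
    unfolding eigenvalue_list_def D_def char_poly_orthogonal_diagonal[OF A U diag] proots_linear_factors
    by simp
  have len: "length (diag_mat D) = n" using D by (simp add: diag_mat_def)
  have nth: "diag_mat D ! i = D $$ (i, i)" if "i < n" for i using D that by (simp add: diag_mat_def)
  let ?T = "\<lambda>v. transpose_mat U *\<^sub>v v"
  have T: "?T v \<in> carrier_vec n" if "v \<in> carrier_vec n" for v using U that by simp
  have UT: "U *\<^sub>v ?T v = v" if "v \<in> carrier_vec n" for v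
  proof -
    have "(U * transpose_mat U) *\<^sub>v v = U *\<^sub>v ?T v" using U that by (intro assoc_mult_mat_vec) auto
    then show ?thesis using that by (simp add: UU)
  qed
  have iso: "?T u \<bullet> ?T v = u \<bullet> v" if "u \<in> carrier_vec n" "v \<in> carrier_vec n" for u v
  proof -
    have "?T u \<bullet> ?T v = u \<bullet> (U *\<^sub>v ?T v)"
      using U that by (intro transpose_vec_mult_scalar) auto
    then show ?thesis using UT that by simp
  qed
  have DT: "?T (A *\<^sub>v v) = D *\<^sub>v ?T v" if "v \<in> carrier_vec n" for v
  proof -
    have "D *\<^sub>v ?T v = ?T (A *\<^sub>v (U *\<^sub>v ?T v))"
      unfolding D_def using U A that T[OF that] by (simp add: assoc_mult_mat_vec[of _ n n _ n])
    then show ?thesis using UT that by simp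
  qed
  have D_nth: "(D *\<^sub>v v) $ i = D $$ (i, i) * v $ i" if "v \<in> carrier_vec n" "i < n" for v i
  proof -
    have "(D *\<^sub>v v) $ i = (\<Sum>j<n. D $$ (i, j) * v $ j)"
      using D that by (simp add: scalar_prod_def lessThan_atLeast0)
    also have "\<dots> = (\<Sum>j<n. if j = i then D $$ (i, i) * v $ i else 0)"
      using diag D that by (intro sum.cong) (auto simp: diagonal_mat_def D_def[symmetric])
    finally show ?thesis using that by simp
  qed
  have quad: "x \<bullet> (A *\<^sub>v x) = (\<Sum>i<n. D $$ (i, i) * (?T x $ i)\<^sup>2)"
  proof -
    have "x \<bullet> (A *\<^sub>v x) = ?T x \<bullet> (D *\<^sub>v ?T x)" using iso[of x "A *\<^sub>v x"] DT x A by simp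
    also have "\<dots> = (\<Sum>i<n. ?T x $ i * (D *\<^sub>v ?T x) $ i)"
      using D by (simp add: scalar_prod_def lessThan_atLeast0)
    also have "\<dots> = (\<Sum>i<n. D $$ (i, i) * (?T x $ i)\<^sup>2)"
      using D_nth[OF T[OF x(1)]] by (intro sum.cong) (auto simp: power2_eq_square)
    finally show ?thesis .
  qed
  have nrm: "x \<bullet> x = (\<Sum>i<n. (?T x $ i)\<^sup>2)"
    using iso[OF x(1) x(1)] U by (simp add: scalar_prod_def lessThan_atLeast0 power2_eq_square)
  show "x \<bullet> (A *\<^sub>v x) \<le> nth_eigenvalue A n * (x \<bullet> x)"
    unfolding quad nrm sum_distrib_left
  proof (intro sum_mono mult_right_mono)
    fix i assume "i \<in> {..<n}"
    then show "D $$ (i, i) \<le> nth_eigenvalue A n"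
      using nth_le_sort_last[of i "diag_mat D"] by (simp add: nth_eigenvalue_def ev len nth)
  qed auto
  assume pos: "nth_eigenvalue A 2 > 0"
  obtain k where k: "k < n" "\<And>j. j < n \<Longrightarrow> j \<noteq> k \<Longrightarrow> nth_eigenvalue A 2 \<le> D $$ (j, j)"
    using nth_sort_Suc_0_le[of "diag_mat D"] n len nth unfolding nth_eigenvalue_def ev
    by (metis One_nat_def diff_Suc_1 numeral_2_eq_2)
  \<comment> \<open>\<open>D\<close> annihilates the coordinate vector of \<open>w\<close>, and its
    diagonal entries away from \<open>k\<close> are positive; so \<open>w\<close> lives on
    coordinate \<open>k\<close> alone.\<close>
  have w0: "?T w $ j = 0" if j: "j < n" "j \<noteq> k" for j
  proof -
    have "(D *\<^sub>v ?T w) $ j = ?T (0\<^sub>v n) $ j" using DT[OF w(1)] w(3) by simp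
    also have "\<dots> = 0" using U j by (simp add: scalar_prod_def)
    finally show ?thesis using D_nth[OF T[OF w(1)] j(1)] k(2)[OF j] pos by simp
  qed
  have expand: "?T w \<bullet> v = ?T w $ k * v $ k" if "v \<in> carrier_vec n" for v
  proof -
    have "?T w \<bullet> v = (\<Sum>j<n. ?T w $ j * v $ j)"
      using that by (simp add: scalar_prod_def lessThan_atLeast0)
    also have "\<dots> = (\<Sum>j<n. if j = k then ?T w $ k * v $ k else 0)"
      using w0 by (intro sum.cong) auto
    finally show ?thesis using k(1) by simp
  qed
  \<comment> \<open>As \<open>w\<close> is nonzero, its coordinate at \<open>k\<close> is nonzero;
    orthogonality then kills the coordinate of \<open>x\<close> at \<open>k\<close>.\<close>
  have "w \<bullet> w \<noteq> 0" using w conjugate_square_eq_0_vec[OF w(1)] by (simp add: conjugate_real_vec)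
  then have "?T w $ k \<noteq> 0" using iso[OF w(1) w(1)] expand[OF T[OF w(1)]] by auto
  moreover have "?T w $ k * ?T x $ k = 0"
    using iso[OF w(1) x(1)] expand[OF T[OF x(1)]] x(2) by simp
  ultimately have "?T x $ k = 0" by simp
  then show "nth_eigenvalue A 2 * (x \<bullet> x) \<le> x \<bullet> (A *\<^sub>v x)"
    unfolding quad nrm sum_distrib_left
    using k(2) by (intro sum_mono) (metis lessThan_iff mult_right_mono mult_zero_right power_zero_numeral order_refl zero_le_power2)
qed

section \<open>Dirichlet energy and toughness\<close>

definition adj_weight :: "('a, 'b) pre_digraph \<Rightarrow> 'a \<Rightarrow> 'a \<Rightarrow> real" where
  "adj_weight G u v = of_bool (u \<rightarrow>\<^bsub>G\<^esub> v)"

text \<open>The Laplacian quadratic form; the factor one half compensates for each edge appearing as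
  two ordered pairs.\<close>

definition dirichlet :: "('a, 'b) pre_digraph \<Rightarrow> ('a \<Rightarrow> real) \<Rightarrow> real" where
  "dirichlet G f = (\<Sum>u\<in>verts G. \<Sum>v\<in>verts G. adj_weight G u v * (f u - f v)\<^sup>2) / 2"

context graph
begin

lemma adj_weight_sym: "adj_weight G u v = adj_weight G v u"
  using sym_arcs unfolding adj_weight_def symmetric_def by (auto dest: symD)

lemma out_degree_eq_sum: "real (out_degree G u) = (\<Sum>v\<in>verts G. adj_weight G u v)"
proof -
  have "inj_on (head G) (out_arcs G u)"
    using no_multi_arcs by (auto simp: inj_on_def out_arcs_def arc_to_ends_def)
  moreover have "head G ` out_arcs G u = {v \<in> verts G. u \<rightarrow> v}"
    by (auto simp: out_arcs_def arcs_ends_def arc_to_ends_def image_iff)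
  ultimately have "out_degree G u = card {v \<in> verts G. u \<rightarrow> v}"
    unfolding out_degree_def by (metis card_image)
  then show ?thesis by (simp add: adj_weight_def of_bool_def sum.If_cases Int_def)
qed

lemma dirichlet_expand:
  fixes f :: "'a \<Rightarrow> real"
  shows "dirichlet G f = (\<Sum>u\<in>verts G. out_degree G u * (f u)\<^sup>2)
     - (\<Sum>u\<in>verts G. \<Sum>v\<in>verts G. adj_weight G u v * (f u * f v))"
proof -
  let ?V = "verts G" and ?e = "adj_weight G"
  have 1: "(\<Sum>u\<in>?V. \<Sum>v\<in>?V. ?e u v * (f u)\<^sup>2) = (\<Sum>u\<in>?V. out_degree G u * (f u)\<^sup>2)"
    by (simp add: out_degree_eq_sum sum_distrib_right)
  have "(\<Sum>u\<in>?V. \<Sum>v\<in>?V. ?e u v * (f v)\<^sup>2) = (\<Sum>v\<in>?V. \<Sum>u\<in>?V. ?e v u * (f v)\<^sup>2)"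
    by (subst sum.swap) (simp add: adj_weight_sym)
  then have 2: "(\<Sum>u\<in>?V. \<Sum>v\<in>?V. ?e u v * (f v)\<^sup>2) = (\<Sum>u\<in>?V. out_degree G u * (f u)\<^sup>2)"
    using 1 by simp
  have "(\<Sum>u\<in>?V. \<Sum>v\<in>?V. ?e u v * (f u - f v)\<^sup>2) =
    (\<Sum>u\<in>?V. \<Sum>v\<in>?V. ?e u v * (f u)\<^sup>2 + ?e u v * (f v)\<^sup>2 - 2 * (?e u v * (f u * f v)))"
    by (intro sum.cong refl) (simp add: power2_diff algebra_simps)
  also have "\<dots> = (\<Sum>u\<in>?V. \<Sum>v\<in>?V. ?e u v * (f u)\<^sup>2) + (\<Sum>u\<in>?V. \<Sum>v\<in>?V. ?e u v * (f v)\<^sup>2)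
     - 2 * (\<Sum>u\<in>?V. \<Sum>v\<in>?V. ?e u v * (f u * f v))"
    by (simp only: sum.distrib sum_subtractf sum_distrib_left[symmetric])
  finally show ?thesis unfolding dirichlet_def 1 2 by simp
qed

lemma dirichlet_nonneg: "0 \<le> dirichlet G f"
  by (simp add: dirichlet_def adj_weight_def sum_nonneg)

lemma dirichlet_shift: "dirichlet G (\<lambda>v. f v - c) = dirichlet G f"
  by (simp add: dirichlet_def)

section \<open>Passing between vectors and functions on the vertices\<close>

lemma sum_nth_verts:
  assumes "distinct vs" "set vs = verts G"
  shows "(\<Sum>i<length vs. g (vs ! i)) = (\<Sum>v\<in>verts G. g v)"
  using sum.reindex_bij_betw[OF bij_betw_nth[OF assms(1) refl assms(2)[symmetric]]] by simp

lemma laplacian_mult_nth: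
  fixes f :: "'a \<Rightarrow> real"
  assumes vs: "distinct vs" "set vs = verts G" and i: "i < length vs"
  shows "(laplacian_mat G vs *\<^sub>v vec (length vs) (\<lambda>j. f (vs ! j))) $ i =
    out_degree G (vs ! i) * f (vs ! i) - (\<Sum>v\<in>verts G. adj_weight G (vs ! i) v * f v)"
proof -
  have "(laplacian_mat G vs *\<^sub>v vec (length vs) (\<lambda>j. f (vs ! j))) $ i =
    (\<Sum>j<length vs. (if i = j then real (out_degree G (vs ! i)) else 0) * f (vs ! j)
       - adj_weight G (vs ! i) (vs ! j) * f (vs ! j))"
    using i by (simp add: laplacian_mat_def degree_mat_def adjacency_mat_def scalar_prod_def
        lessThan_atLeast0 adj_weight_def of_bool_def left_diff_distrib)
  also have "\<dots> = (\<Sum>j<length vs. (if i = j then real (out_degree G (vs ! i)) else 0) * f (vs ! j))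
      - (\<Sum>v\<in>verts G. adj_weight G (vs ! i) v * f v)"
    by (simp only: sum_subtractf sum_nth_verts[OF vs, of "\<lambda>v. adj_weight G (vs ! i) v * f v"])
  also have "(\<Sum>j<length vs. (if i = j then real (out_degree G (vs ! i)) else 0) * f (vs ! j)) =
      (\<Sum>j<length vs. if i = j then out_degree G (vs ! i) * f (vs ! i) else 0)"
    by (intro sum.cong) auto
  finally show ?thesis using i by simp
qed

lemma laplacian_quadratic_form:
  fixes f :: "'a \<Rightarrow> real"
  assumes vs: "distinct vs" "set vs = verts G"
  defines "x \<equiv> vec (length vs) (\<lambda>i. f (vs ! i))"
  shows "x \<bullet> (laplacian_mat G vs *\<^sub>v x) = dirichlet G f"
proof -
  let ?g = "\<lambda>u. f u * (out_degree G u * f u - (\<Sum>v\<in>verts G. adj_weight G u v * f v))"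
  have "x \<bullet> (laplacian_mat G vs *\<^sub>v x) = (\<Sum>i<length vs. x $ i * (laplacian_mat G vs *\<^sub>v x) $ i)"
    by (simp add: scalar_prod_def lessThan_atLeast0 laplacian_mat_def degree_mat_def adjacency_mat_def)
  also have "\<dots> = (\<Sum>i<length vs. ?g (vs ! i))"
    unfolding x_def using laplacian_mult_nth[OF vs] by (intro sum.cong) auto
  also have "\<dots> = (\<Sum>u\<in>verts G. ?g u)" by (rule sum_nth_verts[OF vs])
  also have "\<dots> = dirichlet G f"
    unfolding dirichlet_expand by (simp add: right_diff_distrib sum_subtractf sum_distrib_left
        power2_eq_square mult.left_commute mult.assoc)
  finally show ?thesis .
qed

text \<open>\<open>var\<close> is the squared norm of \<open>f\<close> minus its mean. Centering
  leaves the energy unchanged and gives a vector orthogonal to the all-ones vector, which lies in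
  the kernel of the Laplacian; so the Rayleigh bounds apply.\<close>

lemma dirichlet_bounds:
  fixes f :: "'a \<Rightarrow> real"
  assumes vs: "distinct vs" "set vs = verts G" and n: "card (verts G) = n" "2 \<le> n"
  defines "L \<equiv> laplacian_mat G vs" and "var \<equiv> (\<Sum>v\<in>verts G. (f v)\<^sup>2) - (\<Sum>v\<in>verts G. f v)\<^sup>2 / n"
  shows "dirichlet G f \<le> nth_eigenvalue L n * var"
    and "0 < nth_eigenvalue L 2 \<Longrightarrow> nth_eigenvalue L 2 * var \<le> dirichlet G f"
proof -
  have len: "length vs = n" using vs n distinct_card by metis
  define c where "c = (\<Sum>v\<in>verts G. f v) / n"
  define w where "w = vec n (\<lambda>_. 1 :: real)"
  define x where "x = vec n (\<lambda>i. f (vs ! i) - c)"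
  have L: "L \<in> carrier_mat n n"
    unfolding L_def laplacian_mat_def degree_mat_def adjacency_mat_def len by auto
  have sym: "transpose_mat L = L"
  proof (rule eq_matI)
    fix i j assume "i < dim_row L" "j < dim_col L"
    then show "transpose_mat L $$ (i, j) = L $$ (i, j)"
      using adj_weight_sym[of "vs ! i" "vs ! j"] L
      by (auto simp: L_def laplacian_mat_def degree_mat_def adjacency_mat_def adj_weight_def len)
  qed (use L in auto)
  have w: "w \<in> carrier_vec n" "w \<noteq> 0\<^sub>v n"
    using n(2) by (auto simp: w_def dest: arg_cong[of _ _ "\<lambda>v. v $ 0"])
  have Lw: "L *\<^sub>v w = 0\<^sub>v n"
  proof (rule eq_vecI)
    fix i assume "i < dim_vec (0\<^sub>v n :: real vec)"
    then show "(L *\<^sub>v w) $ i = 0\<^sub>v n $ i"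
      using laplacian_mult_nth[OF vs, of i "\<lambda>_. 1"] by (simp add: L_def w_def len out_degree_eq_sum)
  qed (use L in auto)
  have sum_x: "(\<Sum>i<n. f (vs ! i) - c) = 0"
    using sum_nth_verts[OF vs, of f] n(2) by (simp add: sum_subtractf len c_def)
  have wx: "w \<bullet> x = 0" using sum_x by (simp add: w_def x_def scalar_prod_def lessThan_atLeast0)
  have "x \<bullet> x = (\<Sum>i<n. (f (vs ! i) - c)\<^sup>2)"
    by (simp add: x_def scalar_prod_def lessThan_atLeast0 power2_eq_square)
  also have "\<dots> = (\<Sum>v\<in>verts G. (f v - c)\<^sup>2)"
    using sum_nth_verts[OF vs, of "\<lambda>v. (f v - c)\<^sup>2"] by (simp add: len)
  also have "\<dots> = (\<Sum>v\<in>verts G. (f v)\<^sup>2 + c\<^sup>2 - 2 * c * f v)"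
    by (intro sum.cong) (auto simp: power2_diff)
  also have "\<dots> = (\<Sum>v\<in>verts G. (f v)\<^sup>2) + n * c\<^sup>2 - 2 * c * (\<Sum>v\<in>verts G. f v)"
    using n(1) by (simp add: sum_subtractf sum.distrib sum_distrib_left)
  also have "\<dots> = var" using n(2) by (simp add: var_def c_def power2_eq_square field_simps)
  finally have xx: "x \<bullet> x = var" .
  have "x \<bullet> (L *\<^sub>v x) = dirichlet G f"
    using laplacian_quadratic_form[OF vs, of "\<lambda>v. f v - c"]
    by (simp add: dirichlet_shift x_def L_def len)
  moreover have "x \<in> carrier_vec n" by (simp add: x_def)
  ultimately show "dirichlet G f \<le> nth_eigenvalue L n * var"
    and "0 < nth_eigenvalue L 2 \<Longrightarrow> nth_eigenvalue L 2 * var \<le> dirichlet G f"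
    using rayleigh_bounds[OF L sym n(2) w Lw _ wx] xx by auto
qed

text \<open>The factors beside the eigenvalues are \<open>n\<close> times the variances of the
  difference and of the sum of the two indicator functions, whose energies coincide.\<close>

lemma separated_pair_bound:
  assumes vs: "distinct vs" "set vs = verts G" and n: "card (verts G) = n" "2 \<le> n"
    and AB: "A \<subseteq> verts G" "B \<subseteq> verts G" "A \<inter> B = {}"
    and sep: "\<And>x y. x \<in> A \<Longrightarrow> y \<in> B \<Longrightarrow> \<not> x \<rightarrow> y"
    and pos: "0 < nth_eigenvalue (laplacian_mat G vs) 2"
  shows "nth_eigenvalue (laplacian_mat G vs) 2 * (n * (card A + card B) - (real (card A) - card B)\<^sup>2)
    \<le> nth_eigenvalue (laplacian_mat G vs) n * (n * (card A + card B) - (real (card A) + card B)\<^sup>2)"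
proof -
  let ?V = "verts G" and ?a = "real (card A)" and ?b = "real (card B)"
  let ?f = "\<lambda>v. of_bool (v \<in> A) + of_bool (v \<in> B) :: real"
  let ?g = "\<lambda>v. of_bool (v \<in> A) - of_bool (v \<in> B) :: real"
  let ?l = "nth_eigenvalue (laplacian_mat G vs)"
  have ind: "(\<Sum>v\<in>?V. of_bool (v \<in> C)) = real (card C)" if "C \<subseteq> ?V" for C
    using that by (simp add: of_bool_def sum.If_cases Int_absorb1)
  have sums: "(\<Sum>v\<in>?V. ?f v) = ?a + ?b" "(\<Sum>v\<in>?V. ?g v) = ?a - ?b"
    using ind AB by (simp_all add: sum.distrib sum_subtractf)
  have "(?f v)\<^sup>2 = ?f v" "(?g v)\<^sup>2 = ?f v" for v
    using AB(3) by (cases "v \<in> A"; cases "v \<in> B"; auto)+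
  then have squares: "(\<Sum>v\<in>?V. (?f v)\<^sup>2) = ?a + ?b" "(\<Sum>v\<in>?V. (?g v)\<^sup>2) = ?a + ?b"
    by (simp_all only: sums)
  \<comment> \<open>The endpoints of an edge both avoid \<open>A\<close> or both avoid
    \<open>B\<close>, and there \<open>?f\<close> and \<open>?g\<close> agree up to a common
    sign.\<close>
  have "adj_weight G u v * (?f u - ?f v)\<^sup>2 = adj_weight G u v * (?g u - ?g v)\<^sup>2" for u v
  proof (cases "u \<rightarrow> v")
    case True
    then have "v \<rightarrow> u" using adj_weight_sym[of u v] by (simp add: adj_weight_def of_bool_def split: if_splits)
    have "\<not> (u \<in> A \<and> v \<in> B)" "\<not> (v \<in> A \<and> u \<in> B)" "\<not> (u \<in> A \<and> u \<in> B)" "\<not> (v \<in> A \<and> v \<in> B)"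
      using True \<open>v \<rightarrow> u\<close> sep AB(3) by blast+
    then show ?thesis
      by (cases "u \<in> A"; cases "u \<in> B"; cases "v \<in> A"; cases "v \<in> B") simp_all
  qed (simp add: adj_weight_def)
  then have "dirichlet G ?f = dirichlet G ?g" by (simp only: dirichlet_def)
  then have "?l 2 * (?a + ?b - (?a - ?b)\<^sup>2 / n) \<le> ?l n * (?a + ?b - (?a + ?b)\<^sup>2 / n)"
    using dirichlet_bounds(1)[OF vs n, of ?f] dirichlet_bounds(2)[OF vs n pos, of ?g] squares sums by simp
  then have "?l 2 * (?a + ?b - (?a - ?b)\<^sup>2 / n) * n \<le> ?l n * (?a + ?b - (?a + ?b)\<^sup>2 / n) * n"
    by (intro mult_right_mono) auto
  then show ?thesis using n(2) by (simp add: algebra_simps)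
qed

text \<open>Testing differences of two indicators shows that any two vertices of \<open>C\<close>
  have degree sum at least twice the second eigenvalue. Hence the average degree on \<open>C\<close>
  is at least that eigenvalue, while the energy of the indicator of \<open>C\<close>, which is the
  degree sum \<open>e\<close>, is bounded above by the largest one.\<close>

lemma independent_set_bound:
  assumes vs: "distinct vs" "set vs = verts G" and n: "card (verts G) = n"
    and C: "C \<subseteq> verts G" "2 \<le> card C"
    and indep: "\<And>x y. x \<in> C \<Longrightarrow> y \<in> C \<Longrightarrow> \<not> x \<rightarrow> y"
    and pos: "0 < nth_eigenvalue (laplacian_mat G vs) 2"
  shows "nth_eigenvalue (laplacian_mat G vs) 2 * n
    \<le> nth_eigenvalue (laplacian_mat G vs) n * (real n - card C)"
proof -
  let ?V = "verts G" and ?c = "real (card C)" and ?d = "\<lambda>v. real (out_degree G v)"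
  let ?l = "nth_eigenvalue (laplacian_mat G vs)"
  have n2: "2 \<le> n" using C n card_mono[OF finite_verts C(1)] by simp
  have finC: "finite C" by (rule finite_subset[OF C(1) finite_verts])
  have restrict: "(\<Sum>v\<in>?V. g v) = (\<Sum>v\<in>C. g v)" if "\<And>v. v \<notin> C \<Longrightarrow> g v = 0" for g :: "'a \<Rightarrow> real"
    using C(1) that by (intro sum.mono_neutral_right) auto
  \<comment> \<open>For functions supported on an independent set all cross terms of the energy
    vanish.\<close>
  have dir: "dirichlet G f = (\<Sum>v\<in>C. ?d v * (f v)\<^sup>2)" if f: "\<And>v. v \<notin> C \<Longrightarrow> f v = 0" for f :: "'a \<Rightarrow> real"
  proof -
    have zero: "adj_weight G u v * (f u * f v) = 0" for u v
    proof (cases "u \<in> C \<and> v \<in> C")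
      case True
      then show ?thesis using indep[of u v] by (simp add: adj_weight_def)
    next
      case False
      then have "f u = 0 \<or> f v = 0" using f[of u] f[of v] by argo
      then show ?thesis by (simp only: mult_eq_0_iff disj_commute simp_thms)
    qed
    have "(\<Sum>u\<in>?V. \<Sum>v\<in>?V. adj_weight G u v * (f u * f v)) = 0"
      by (rule sum.neutral, rule ballI, rule sum.neutral, rule ballI, rule zero)
    then have "dirichlet G f = (\<Sum>v\<in>?V. ?d v * (f v)\<^sup>2)"
      by (simp only: dirichlet_expand diff_zero)
    also have "\<dots> = (\<Sum>v\<in>C. ?d v * (f v)\<^sup>2)" by (rule restrict) (simp add: f)
    finally show ?thesis .
  qed
  have pair: "2 * ?l 2 \<le> ?d i + ?d j" if ij: "i \<in> C" "j \<in> C" "i \<noteq> j" for i j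
  proof -
    let ?f = "\<lambda>v. of_bool (v = i) - of_bool (v = j) :: real"
    have f: "?f v = 0" if "v \<notin> C" for v using that ij by auto
    have sub: "(\<Sum>v\<in>C. g v * of_bool (v = k)) = g k" if "k \<in> C" for k and g :: "'a \<Rightarrow> real"
      using that finC by (simp add: of_bool_def if_distrib cong: if_cong)
    have sq: "(?f v)\<^sup>2 = of_bool (v = i) + of_bool (v = j)" for v using ij(3) by auto
    have "dirichlet G ?f = (\<Sum>v\<in>C. ?d v * (?f v)\<^sup>2)" using f by (rule dir)
    then have energy: "dirichlet G ?f = ?d i + ?d j"
      unfolding sq by (simp only: distrib_left sum.distrib sub[OF ij(1)] sub[OF ij(2)])
    have one: "(\<Sum>v\<in>C. of_bool (v = k)) = (1 :: real)" if "k \<in> C" for k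
      using sub[OF that, of "\<lambda>_. 1"] by simp
    have "(\<Sum>v\<in>?V. (?f v)\<^sup>2) = (\<Sum>v\<in>C. (?f v)\<^sup>2)"
      by (rule restrict) (use ij in auto)
    then have two: "(\<Sum>v\<in>?V. (?f v)\<^sup>2) = 2"
      unfolding sq by (simp only: sum.distrib one[OF ij(1)] one[OF ij(2)])
    have "(\<Sum>v\<in>?V. ?f v) = (\<Sum>v\<in>C. ?f v)" using f by (rule restrict)
    then have null: "(\<Sum>v\<in>?V. ?f v) = 0"
      by (simp only: sum_subtractf one[OF ij(1)] one[OF ij(2)])
    show ?thesis using dirichlet_bounds(2)[OF vs n n2 pos, of ?f] energy two null by simp
  qed
  define e where "e = (\<Sum>v\<in>C. ?d v)"
  \<comment> \<open>Summed over all ordered pairs of distinct vertices, each degree occurs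
    \<open>2 * (?c - 1)\<close> times.\<close>
  have "(\<Sum>i\<in>C. \<Sum>j\<in>C - {i}. 2 * ?l 2) \<le> (\<Sum>i\<in>C. \<Sum>j\<in>C - {i}. ?d i + ?d j)"
    using pair by (intro sum_mono) auto
  also have "(\<Sum>i\<in>C. \<Sum>j\<in>C - {i}. ?d i + ?d j) = (\<Sum>i\<in>C. (?c - 2) * ?d i + e)"
  proof (intro sum.cong refl)
    fix i assume i: "i \<in> C"
    have "(\<Sum>j\<in>C - {i}. ?d j) = e - ?d i" using i finC by (simp add: e_def sum_diff1)
    then show "(\<Sum>j\<in>C - {i}. ?d i + ?d j) = (?c - 2) * ?d i + e"
      using i C(2) by (simp add: sum.distrib card_Diff_singleton of_nat_diff algebra_simps)
  qed
  also have "\<dots> = (?c - 2) * e + ?c * e"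
    unfolding sum.distrib by (simp add: e_def sum_distrib_left)
  also have "\<dots> = 2 * (?c - 1) * e" by (simp add: algebra_simps)
  also have "(\<Sum>i\<in>C. \<Sum>j\<in>C - {i}. 2 * ?l 2) = 2 * (?c - 1) * (?c * ?l 2)"
  proof -
    have "(\<Sum>j\<in>C - {i}. 2 * ?l 2) = 2 * (?c - 1) * ?l 2" if "i \<in> C" for i
      using that C(2) by (simp add: card_Diff_singleton of_nat_diff)
    then have "(\<Sum>i\<in>C. \<Sum>j\<in>C - {i}. 2 * ?l 2) = (\<Sum>i\<in>C. 2 * (?c - 1) * ?l 2)"
      by (rule sum.cong[OF refl])
    then show ?thesis by simp
  qed
  finally have lower: "?c * ?l 2 \<le> e" using C(2) by simp
  let ?f = "\<lambda>v. of_bool (v \<in> C) :: real"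
  have f: "?f v = 0" if "v \<notin> C" for v using that by auto
  have "dirichlet G ?f = (\<Sum>v\<in>C. ?d v * (?f v)\<^sup>2)" using f by (rule dir)
  also have "\<dots> = e" unfolding e_def by (intro sum.cong) auto
  finally have "dirichlet G ?f = e" .
  moreover have "(\<Sum>v\<in>?V. ?f v) = ?c" by (subst restrict) auto
  moreover have "(\<Sum>v\<in>?V. (?f v)\<^sup>2) = ?c" by (subst restrict) auto
  ultimately have "e \<le> ?l n * (?c - ?c\<^sup>2 / n)"
    using dirichlet_bounds(1)[OF vs n n2, of ?f] by simp
  with lower have "?c * ?l 2 \<le> ?l n * (?c - ?c\<^sup>2 / n)" by simp
  then have "?c * ?l 2 * n \<le> ?l n * (?c - ?c\<^sup>2 / n) * n" by (intro mult_right_mono) auto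
  then have "?c * (?l 2 * n) \<le> ?c * (?l n * (n - ?c))"
    using n2 by (simp add: algebra_simps power2_eq_square)
  then show ?thesis using C(2) by (simp add: mult_le_cancel_left)
qed

end

section \<open>Grouping the parts and the toughness bound\<close>

lemma card_le_card_Union:
  assumes "finite F" "disjoint F" "\<And>C. C \<in> F \<Longrightarrow> finite C \<and> C \<noteq> {}"
  shows "card F \<le> card (\<Union>F)"
    and "K \<in> F \<Longrightarrow> 2 \<le> card K \<Longrightarrow> card F < card (\<Union>F)"
proof -
  have 1: "card (\<Union>F) = (\<Sum>C\<in>F. card C)"
    using assms by (intro card_Union_disjoint) auto
  have 2: "1 \<le> card C" if "C \<in> F" for C
    using assms(3)[OF that] by (simp add: Suc_le_eq card_gt_0_iff)
  show "card F \<le> card (\<Union>F)" using sum_mono[of F "\<lambda>_. 1" card] 1 2 by simp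
  assume "K \<in> F" "2 \<le> card K"
  then have "(\<Sum>C\<in>F. 1) < (\<Sum>C\<in>F. card C)"
    using 2 assms(1) by (intro sum_strict_mono_ex1) (auto intro!: bexI[of _ K])
  then show "card F < card (\<Union>F)" using 1 by simp
qed

text \<open>Every part contributes at least one vertex, so an even number of parts is simply halved.
  For an odd number, the side with fewer parts receives a part \<open>K\<close> of size at least two
  as compensation.\<close>

lemma balanced_grouping:
  assumes F: "finite F" "disjoint F" "\<And>C. C \<in> F \<Longrightarrow> finite C \<and> C \<noteq> {}"
    and "2 \<le> card F" and nontriv: "even (card F) \<or> (\<exists>K\<in>F. 2 \<le> card K)"
  obtains F1 where "F1 \<subseteq> F" "card F \<le> 2 * card (\<Union>F1)" "card F \<le> 2 * card (\<Union>(F - F1))"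
proof -
  have bound: "card F' \<le> card (\<Union>F')" if "F' \<subseteq> F" for F'
    using that F finite_subset by (intro card_le_card_Union) (auto intro: pairwise_subset)
  have diff: "card (F - F1) = card F - card F1" if "F1 \<subseteq> F" for F1
    using that F(1) by (meson card_Diff_subset finite_subset)
  show ?thesis
  proof (cases "even (card F)")
    case True
    obtain F1 where F1: "F1 \<subseteq> F" "card F1 = card F div 2"
      using obtain_subset_with_card_n[of "card F div 2" F] by auto
    show ?thesis
      using that[OF F1(1)] bound[OF F1(1)] bound[of "F - F1"] diff[OF F1(1)] F1(2) True by fastforce
  next
    case False
    then obtain K k where K: "K \<in> F" "2 \<le> card K" and k: "card F = 2 * k + 1"
      using nontriv by (auto elim: oddE)
    have k1: "1 \<le> k" using k assms(4) by simp
    \<comment> \<open>With \<open>K\<close> and \<open>k - 1\<close> further parts one side has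
      \<open>k\<close> parts but at least \<open>k + 1\<close> vertices; the other side has
      \<open>k + 1\<close> parts.\<close>
    have "k - 1 \<le> card (F - {K})" using K(1) k F(1) by simp
    then obtain F0 where F0: "F0 \<subseteq> F - {K}" "card F0 = k - 1" "finite F0"
      using obtain_subset_with_card_n[of "k - 1" "F - {K}"] by auto
    let ?F1 = "insert K F0"
    have sub: "?F1 \<subseteq> F" using F0 K by auto
    have "K \<notin> F0" using F0 by auto
    then have card: "card ?F1 = k" using F0 k1 by simp
    have "card ?F1 < card (\<Union>?F1)"
      using sub F finite_subset K by (intro card_le_card_Union(2)[of _ K]) (auto intro: pairwise_subset)
    then show ?thesis
      using that[OF sub] bound[of "F - ?F1"] diff[OF sub] card k by fastforce
  qed
qed

text \<open>When the largest eigenvalue exceeds the second, rearranging bounds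
  \<open>card T / card F\<close> below by the second eigenvalue over the difference of the two,
  which is a lower bound on toughness.\<close>

theorem (in graph) laplacian_toughness_bound:
  assumes vs: "distinct vs" "set vs = verts G" and T: "T \<subseteq> verts G"
    and F: "\<Union>F = verts G - T" "disjoint F" "{} \<notin> F" "2 \<le> card F"
    and closed: "\<And>C x y. C \<in> F \<Longrightarrow> x \<in> C \<Longrightarrow> y \<in> verts G - T \<Longrightarrow> x \<rightarrow> y \<Longrightarrow> y \<in> C"
    and pos: "0 < nth_eigenvalue (laplacian_mat G vs) 2"
  shows "nth_eigenvalue (laplacian_mat G vs) 2 * (card T + card F)
    \<le> nth_eigenvalue (laplacian_mat G vs) (card (verts G)) * card T"
proof -
  let ?n = "card (verts G)" and ?l = "nth_eigenvalue (laplacian_mat G vs)"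
  let ?c = "real (card F)" and ?t = "real (card T)"
  have finF: "finite F" using F(1) by (metis finite_Diff finite_UnionD finite_verts)
  have FC: "finite C \<and> C \<noteq> {}" if "C \<in> F" for C
    using F(1,3) that by (metis Union_upper finite_Diff finite_subset finite_verts)
  have disj: "x \<notin> D" if "C \<in> F" "D \<in> F" "C \<noteq> D" "x \<in> C" for C D x
    using F(2) that by (auto simp: disjoint_def)
  have n_eq: "?n = card T + card (\<Union>F)"
    unfolding F(1) using T by (metis card_Diff_subset card_mono finite_subset finite_verts le_add_diff_inverse)
  have m: "card F \<le> card (\<Union>F)" using card_le_card_Union(1)[OF finF F(2) FC] .
  have n2: "2 \<le> ?n" using n_eq m F(4) by simp
  show ?thesis
  proof (cases "even (card F) \<or> (\<exists>K\<in>F. 2 \<le> card K)")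
    case True
    obtain F1 where F1: "F1 \<subseteq> F" "card F \<le> 2 * card (\<Union>F1)" "card F \<le> 2 * card (\<Union>(F - F1))"
      using balanced_grouping[OF finF F(2) FC F(4) True] by blast
    let ?A = "\<Union>F1" and ?B = "\<Union>(F - F1)"
    define a b where "a = real (card ?A)" and "b = real (card ?B)"
    have AB: "?A \<union> ?B = \<Union>F" "?A \<inter> ?B = {}" using F1(1) disj by blast+
    have sub: "?A \<subseteq> verts G" "?B \<subseteq> verts G" using AB(1) F(1) by auto
    have "card (\<Union>F) = card ?A + card ?B"
      using AB sub by (metis card_Un_disjoint finite_subset finite_verts)
    then have n_ab: "real ?n = ?t + a + b" using n_eq by (simp add: a_def b_def)
    have sep: "\<not> x \<rightarrow> y" if xy: "x \<in> ?A" "y \<in> ?B" for x y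
    proof
      assume "x \<rightarrow> y"
      obtain C D where "C \<in> F1" "x \<in> C" "D \<in> F - F1" "y \<in> D" using xy by blast
      moreover have "y \<in> verts G - T" using xy(2) F(1) by auto
      ultimately show False using closed[of C x y] F1(1) \<open>x \<rightarrow> y\<close> disj[of C D y] by blast
    qed
    have "?l 2 * (?n * (a + b) - (a - b)\<^sup>2) \<le> ?l ?n * (?n * (a + b) - (a + b)\<^sup>2)"
      using separated_pair_bound[OF vs refl n2 sub AB(2) sep pos] by (simp add: a_def b_def)
    also have "?n * (a + b) - (a - b)\<^sup>2 = ?t * (a + b) + 4 * a * b"
      unfolding n_ab by (simp add: algebra_simps power2_eq_square)
    also have "?n * (a + b) - (a + b)\<^sup>2 = ?t * (a + b)"
      unfolding n_ab by (simp add: algebra_simps power2_eq_square)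
    finally have main: "?l 2 * (?t * (a + b) + 4 * a * b) \<le> ?l ?n * (?t * (a + b))" .
    have c: "?c \<le> 2 * a" "?c \<le> 2 * b" using F1(2,3) by (auto simp: a_def b_def)
    \<comment> \<open>Adding the two inequalities gives \<open>?c * (a + b) \<le> 4 * a * b\<close>,
      after which the common factor \<open>a + b\<close> cancels.\<close>
    then have "?c * b \<le> 2 * a * b" "?c * a \<le> 2 * b * a"
      by (intro mult_right_mono; simp add: a_def b_def)+
    then have "(?t + ?c) * (a + b) \<le> ?t * (a + b) + 4 * a * b" by (simp add: algebra_simps)
    then have "?l 2 * ((?t + ?c) * (a + b)) \<le> ?l ?n * (?t * (a + b))"
      using main pos by (smt (verit) mult_left_mono)
    then have "(a + b) * (?l 2 * (?t + ?c)) \<le> (a + b) * (?l ?n * ?t)" by (simp add: algebra_simps)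
    moreover have "0 < a + b" using c F(4) by simp
    ultimately show ?thesis by (simp add: mult_le_cancel_left)
  next
    case False
    \<comment> \<open>Now all parts are singletons, so their union is an independent set of size
      \<open>card F\<close> whose complement is \<open>T\<close>.\<close>
    have sing: "card C = 1" if "C \<in> F" for C
      using that FC[OF that] False by (metis One_nat_def Suc_1 Suc_leI card_gt_0_iff le_antisym not_less_eq_eq)
    let ?C = "\<Union>F"
    have "card ?C = (\<Sum>C\<in>F. card C)" using F(2) FC by (intro card_Union_disjoint) auto
    then have card_C: "card ?C = card F" using sing by simp
    have C: "?C \<subseteq> verts G" "2 \<le> card ?C" using F(1,4) card_C by auto
    have "\<not> x \<rightarrow> y" if x: "x \<in> ?C" and y: "y \<in> ?C" for x y
    proof
      assume xy: "x \<rightarrow> y"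
      obtain C where "C \<in> F" "x \<in> C" using x by blast
      then have "y \<in> C" using closed xy y F(1) by blast
      then have "x = y" using sing[OF \<open>C \<in> F\<close>] \<open>x \<in> C\<close> by (metis card_1_singletonE singletonD)
      then show False using xy no_loops by (auto simp: arcs_ends_def arc_to_ends_def)
    qed
    from independent_set_bound[OF vs refl C this pos] show ?thesis
      using n_eq card_C by (simp add: add.commute)
  qed
qed

section \<open>Perfect matchings\<close>

text \<open>Keeping exactly the arcs from each vertex to its partner gives out-degree one, and the
  resulting digraph is symmetric because the partner map is an involution.\<close>

lemma (in graph) matching_fun_imp_one_factor:
  assumes V: "V \<subseteq> verts G" and m: "matching_fun (\<lambda>u v. u \<rightarrow>\<^bsub>G\<^esub> v) V m"
  shows "\<exists>H. k_factor 1 H (G \<restriction> V)"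
proof -
  define H where "H = \<lparr>verts = V, arcs = {e \<in> arcs G. tail G e \<in> V \<and> head G e = m (tail G e)},
    tail = tail G, head = head G\<rparr>"
  have H[simp]: "verts H = V" "tail H = tail G" "head H = head G"
    "arcs H = {e \<in> arcs G. tail G e \<in> V \<and> head G e = m (tail G e)}"
    by (simp_all add: H_def)
  have mV: "m v \<in> V" "m (m v) = v" if "v \<in> V" for v
    using m that by (auto simp: matching_fun_def)
  have arc_ex: "\<exists>e\<in>arcs G. tail G e = v \<and> head G e = m v" if "v \<in> V" for v
    using m that by (force simp: matching_fun_def arcs_ends_def arc_to_ends_def)
  have ends: "arcs_ends H = {(v, m v) | v. v \<in> V}"
    using arc_ex by (auto simp: arcs_ends_def arc_to_ends_def image_iff)
  have "symmetric H"
    unfolding symmetric_def ends using mV by (auto simp: sym_def)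
  then have "graph H"
    using mV finite_subset[OF V finite_verts]
    by unfold_locales (auto simp: arc_to_ends_def dest: no_loops intro: no_multi_arcs)
  moreover have "spanning H (G \<restriction> V)"
    unfolding spanning_def subgraph_def
    using \<open>graph H\<close> V mV
    by (auto simp: compatible_def graph_def digraph_def fin_digraph_def intro!: wellformed_induce_subgraph)
  moreover have "out_degree H v = 1" if v: "v \<in> V" for v
  proof -
    obtain e where e: "e \<in> arcs G" "tail G e = v" "head G e = m v" using arc_ex[OF v] by blast
    have "out_arcs H v = {e}"
      using e v by (auto simp: out_arcs_def arc_to_ends_def intro: no_multi_arcs)
    then show ?thesis by (simp add: out_degree_def)
  qed
  ultimately show ?thesis unfolding k_factor_def by auto
qed

text \<open>Tutte's theorem and parity provide the odd parts. A nonempty uncovered rest is added as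
  one more part, of whatever parity, so that the family covers \<open>V - S\<close>; symmetry of
  adjacency keeps it separated from the others.\<close>

lemma (in graph) no_perfect_matching_imp_scattering_set:
  assumes V: "V \<subseteq> verts G" "even (card V)" and no: "\<nexists>m. matching_fun (\<lambda>u v. u \<rightarrow>\<^bsub>G\<^esub> v) V m"
  obtains S F where "S \<subseteq> V" "\<Union>F = V - S" "disjoint F" "{} \<notin> F" "card S + 2 \<le> card F"
    "\<forall>C\<in>F. \<forall>x\<in>C. \<forall>y\<in>V - S. x \<rightarrow> y \<longrightarrow> y \<in> C"
proof -
  let ?E = "\<lambda>u v. u \<rightarrow>\<^bsub>G\<^esub> v"
  have symE: "symp ?E" using sym_arcs by (auto simp: symmetric_def symp_def dest: symD)
  have finV: "finite V" by (rule finite_subset[OF V(1) finite_verts])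
  obtain S F0 where S: "S \<subseteq> V" and F0: "odd_parts ?E (V - S) F0" "\<not> card F0 \<le> card S"
    using tutte[OF symE finV] no by blast
  obtain F where F: "odd_parts ?E (V - S) F" "card S + 2 \<le> card F"
    using odd_parts_excess_two[OF symE finV V(2) S F0(1)] F0(2) by auto
  have parts: "C \<subseteq> V - S" "C \<noteq> {}" "\<And>x y. x \<in> C \<Longrightarrow> y \<in> V - S \<Longrightarrow> x \<rightarrow> y \<Longrightarrow> y \<in> C" if "C \<in> F" for C
    using F(1) that by (auto simp: odd_parts_def)
  have disj: "disjoint F" using F(1) by (simp add: odd_parts_def)
  let ?R = "V - S - \<Union>F"
  show ?thesis
  proof (cases "?R = {}")
    case True
    then have "\<Union>F = V - S" using parts(1) by blast
    then show ?thesis using that[OF S _ disj _ F(2)] parts(2,3) by blast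
  next
    case False
    have finF: "finite F" using F(1) finV odd_parts_finite by blast
    have "\<Union>(insert ?R F) = V - S" using parts(1) by blast
    moreover have "disjoint (insert ?R F)"
      using disj by (auto simp: disjoint_def)
    moreover have "{} \<notin> insert ?R F" using False parts(2) by auto
    moreover have "card S + 2 \<le> card (insert ?R F)"
      using F(2) finF card_insert_le[of F ?R] by linarith
    moreover have closed: "y \<in> C" if C: "C \<in> insert ?R F" "x \<in> C" "y \<in> V - S" "x \<rightarrow> y" for C x y
    proof (cases "C \<in> F")
      case True
      then show ?thesis using parts(3) C by blast
    next
      case False
      then have "x \<in> ?R" "C = ?R" using C by auto
      moreover have "y \<rightarrow> x" using symE C(4) by (rule sympD)
      ultimately show ?thesis using parts(3) C(3) by blast
    qed
    ultimately show ?thesis using closed by (intro that[OF S]) blast+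
  qed
qed

theorem theorem9:
  fixes G :: "('a, 'b) pre_digraph" and vs :: "'a list" and n s :: nat and \<mu> :: "nat \<Rightarrow> real"
  assumes "graph G"
    and "card (verts G) = n"
    and "arcs G \<noteq> {}"
    and "distinct vs" and "set vs = verts G"
    and "\<And>i. 1 \<le> i \<Longrightarrow> i \<le> n \<Longrightarrow> \<mu> i = nth_eigenvalue (laplacian_mat G vs) i"
    and "2 \<le> s" and "s < n" and "even (n + s)"
    and "\<mu> 2 / \<mu> n > real s / (real s + 2)"
  shows "factor_critical 1 s G"
  unfolding factor_critical_def
proof (intro allI impI)
  interpret graph G by fact
  fix X assume "X \<subseteq> verts G \<and> card X = s"
  then have X: "X \<subseteq> verts G" "card X = s" by auto
  let ?l = "nth_eigenvalue (laplacian_mat G vs)"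
  have n2: "2 \<le> n" using assms by simp
  have ratio: "real s / (real s + 2) < ?l 2 / ?l n" using assms(6)[of 2] assms(6)[of n] assms(10) n2 by simp
  \<comment> \<open>A positive ratio alone would allow both eigenvalues to be negative. Testing the
    indicator of one vertex rules this out, as its energy is nonnegative and its variance
    \<open>1 - 1 / n\<close> is positive.\<close>
  have nonneg: "0 \<le> ?l n"
  proof -
    obtain a where a: "a \<in> verts G" using assms(2) n2 by fastforce
    have "(of_bool (v = a) :: real)\<^sup>2 = of_bool (v = a)" for v by simp
    moreover have "(\<Sum>v\<in>verts G. of_bool (v = a)) = (1 :: real)"
      using a by (simp add: of_bool_def)
    ultimately have "0 \<le> ?l n * (1 - 1 / n)"
      using dirichlet_bounds(1)[OF assms(4,5,2) n2, of "\<lambda>v. of_bool (v = a)"]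
        dirichlet_nonneg[of "\<lambda>v. of_bool (v = a)"]
      by (simp only: power_one)
    moreover have "0 < 1 - 1 / real n" using n2 by simp
    ultimately show ?thesis by (simp add: zero_le_mult_iff)
  qed
  have "0 \<le> real s / (real s + 2)" by simp
  then have "0 < ?l 2 / ?l n" using ratio by linarith
  \<comment> \<open>Division by zero yields zero, so the positive ratio also excludes
    \<open>?l n = 0\<close>.\<close>
  then have pos: "0 < ?l n" "0 < ?l 2" using nonneg by (auto simp: zero_less_divide_iff)
  then have less: "s * ?l n < (real s + 2) * ?l 2" using ratio by (simp add: field_simps)
  let ?V = "verts G - X"
  have card_V: "card ?V = n - s" using X assms(2) by (simp add: card_Diff_subset finite_subset)
  have "\<exists>m. matching_fun (\<lambda>u v. u \<rightarrow>\<^bsub>G\<^esub> v) ?V m"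
  proof (rule ccontr)
    assume no: "\<nexists>m. matching_fun (\<lambda>u v. u \<rightarrow>\<^bsub>G\<^esub> v) ?V m"
    have even: "even (card ?V)" using card_V assms(8,9) by simp
    obtain S F where S: "S \<subseteq> ?V" and F: "\<Union>F = ?V - S" "disjoint F" "{} \<notin> F" "card S + 2 \<le> card F"
      and closed: "\<forall>C\<in>F. \<forall>x\<in>C. \<forall>y\<in>?V - S. x \<rightarrow>\<^bsub>G\<^esub> y \<longrightarrow> y \<in> C"
      by (rule no_perfect_matching_imp_scattering_set[OF Diff_subset even no])
    let ?T = "X \<union> S"
    have diff: "verts G - ?T = ?V - S" by auto
    have T: "?T \<subseteq> verts G" using X S by auto
    have "card ?T = s + card S"
      using X S by (subst card_Un_disjoint) (auto intro: finite_subset)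
    define t c where "t = real (card S)" and "c = real (card F)"
    have card_T: "real (card ?T) = s + t" using \<open>card ?T = s + card S\<close> by (simp add: t_def)
    have c: "t + 2 \<le> c" using F(4) by (simp add: t_def c_def flip: of_nat_add)
    have "?l 2 * (card ?T + c) \<le> ?l n * card ?T"
    proof -
      have two: "2 \<le> card F" using F(4) by simp
      have cover: "\<Union>F = verts G - ?T" using F(1) diff by simp
      have "y \<in> C" if "C \<in> F" "x \<in> C" "y \<in> verts G - ?T" "x \<rightarrow>\<^bsub>G\<^esub> y" for C x y
        using closed that diff by blast
      from laplacian_toughness_bound[OF assms(4,5) T cover F(2,3) two this pos(2)] show ?thesis
        using assms(2) by (simp add: c_def)
    qed
    then have tough: "?l 2 * (s + t + c) \<le> ?l n * (s + t)" by (simp add: card_T)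
    \<comment> \<open>Here \<open>2 \<le> s\<close> and the excess of two combine:
      \<open>2 * s + 2 * t \<le> s * (t + 2) \<le> s * c\<close>.\<close>
    have "2 * (s + t) \<le> s * c"
    proof -
      have "2 * t \<le> s * t" using assms(7) by (intro mult_right_mono) (auto simp: t_def)
      moreover have "s * (t + 2) \<le> s * c" using c by (intro mult_left_mono) auto
      ultimately show ?thesis by (simp add: algebra_simps)
    qed
    \<comment> \<open>Adding \<open>s * (s + t)\<close> to both sides brings in the factor
      \<open>s + t + c\<close> of the toughness bound; the ratio hypothesis then closes a strict
      cycle.\<close>
    then have "?l 2 * ((s + t) * (s + 2)) \<le> ?l 2 * (s * (s + t + c))"
      using pos by (intro mult_left_mono) (auto simp: algebra_simps)
    also have "\<dots> \<le> s * (?l n * (s + t))" using mult_left_mono[OF tough, of s] by (simp add: algebra_simps)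
    also have "\<dots> < (s + t) * ((real s + 2) * ?l 2)"
      using mult_strict_left_mono[OF less, of "s + t"] assms(7) by (simp add: t_def algebra_simps)
    finally show False by (simp add: algebra_simps)
  qed
  then show "\<exists>H. k_factor 1 H (G \<restriction> ?V)" using matching_fun_imp_one_factor[of ?V] by blast
qed

end
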